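(* For all partitions $\mu\subseteq\lambda$, as an identity of rational functions in $q$, $$\sum_{T\in\operatorname{SIT}(\lambda/\mu)} q^{|T|}\prod_{k=1}^{m(T)}\frac{1}{1-q^{a(T_{\ge k})}}\;=\;\sum_{D\in\mathcal D(\lambda/\mu)}\ \prod_{(i,j)\in\lambda\setminus D}\frac{q^{h(i,j)}}{1-q^{h(i,j)}}.$$
   Context: Partitions are identified with Young diagrams $\{(i,j):1\le j\le\lambda_i\}$ (English convention); $h(i,j)=\lambda_i-j+\lambda'_j-i+1$ is the hook length in $\lambda$ ($\lambda'$ the conjugate). A standard increasing tableau of shape $\lambda/\mu$ is a filling $T$ of the cells of $\lambda/\mu$ by positive integers, strictly increasing along rows and down columns, whose set of entries is exactly $\{1,\dots,m\}$ for some $m=m(T)$; $\operatorname{SIT}(\lambda/\mu)$ is their set. $|T|$ is the sum of the entries and $a(T_{\ge k})$ the number of cells with entry $\ge k$. Generalized excited diagrams: for $S\subseteq\lambda$, a cell $(i,j)\in S$ is active if $(i+1,j),(i,j+1),(i+1,j+1)\in\lambda\setminus S$; for active $(i,j)$ the type I move replaces $(i,j)$ by $(i+1,j+1)$ and the type II move adds $(i+1,j+1)$ to $S$. $\mathcal D(\lambda/\mu)$ is the set of subsets of $\lambda$ obtainable from the diagram of $\mu$ by sequences of type I and type II moves. *)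

theory Defs
  imports "HOL-Computational_Algebra.Polynomial" "HOL-Computational_Algebra.Fraction_Field"
begin

type_synonym cell = "nat \<times> nat"

definition is_partition :: "nat list \<Rightarrow> bool" where
  "is_partition lam \<longleftrightarrow> sorted_wrt (\<ge>) lam \<and> 0 \<notin> set lam"

definition part :: "nat list \<Rightarrow> nat \<Rightarrow> nat" where
  "part lam i = (if 1 \<le> i \<and> i \<le> length lam then lam ! (i - 1) else 0)"

definition young :: "nat list \<Rightarrow> cell set" where
  "young lam = {(i, j). 1 \<le> i \<and> 1 \<le> j \<and> j \<le> part lam i}"

definition conj_part :: "nat list \<Rightarrow> nat \<Rightarrow> nat" where
  "conj_part lam j = card {i. (i, j) \<in> young lam}"

text \<open>Hook length h(i,j) = lam_i - j + lam'_j - i + 1 (for cells of lam).\<close>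
definition hook :: "nat list \<Rightarrow> cell \<Rightarrow> nat" where
  "hook lam c = (case c of (i, j) \<Rightarrow> (part lam i - j) + (conj_part lam j - i) + 1)"

definition skew :: "nat list \<Rightarrow> nat list \<Rightarrow> cell set" where
  "skew lam mu = young lam - young mu"

definition SIT :: "nat list \<Rightarrow> nat list \<Rightarrow> (cell \<Rightarrow> nat) set" where
  "SIT lam mu = {T. (\<forall>c. c \<notin> skew lam mu \<longrightarrow> T c = 0)
     \<and> (\<forall>i j j'. (i, j) \<in> skew lam mu \<longrightarrow> (i, j') \<in> skew lam mu \<longrightarrow> j < j' \<longrightarrow> T (i, j) < T (i, j'))
     \<and> (\<forall>i i' j. (i, j) \<in> skew lam mu \<longrightarrow> (i', j) \<in> skew lam mu \<longrightarrow> i < i' \<longrightarrow> T (i, j) < T (i', j))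
     \<and> (\<exists>m. T ` skew lam mu = {1..m})}"

text \<open>m(T): the largest entry (entries are exactly 1..m(T)).\<close>
definition mT :: "nat list \<Rightarrow> nat list \<Rightarrow> (cell \<Rightarrow> nat) \<Rightarrow> nat" where
  "mT lam mu T = card (T ` skew lam mu)"

definition weight :: "nat list \<Rightarrow> nat list \<Rightarrow> (cell \<Rightarrow> nat) \<Rightarrow> nat" where
  "weight lam mu T = (\<Sum>c\<in>skew lam mu. T c)"

definition a_ge :: "nat list \<Rightarrow> nat list \<Rightarrow> (cell \<Rightarrow> nat) \<Rightarrow> nat \<Rightarrow> nat" where
  "a_ge lam mu T k = card {c \<in> skew lam mu. T c \<ge> k}"

definition active :: "nat list \<Rightarrow> cell set \<Rightarrow> cell \<Rightarrow> bool" where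
  "active lam S c = (case c of (i, j) \<Rightarrow> c \<in> S \<and>
      (i + 1, j) \<in> young lam - S \<and> (i, j + 1) \<in> young lam - S \<and> (i + 1, j + 1) \<in> young lam - S)"

inductive_set excited :: "nat list \<Rightarrow> nat list \<Rightarrow> cell set set" for lam mu where
  base: "young mu \<in> excited lam mu"
| move1: "S \<in> excited lam mu \<Longrightarrow> active lam S (i, j) \<Longrightarrow>
            (S - {(i, j)}) \<union> {(i + 1, j + 1)} \<in> excited lam mu"
| move2: "S \<in> excited lam mu \<Longrightarrow> active lam S (i, j) \<Longrightarrow>
            S \<union> {(i + 1, j + 1)} \<in> excited lam mu"

definition qX :: "rat poly fract" where
  "qX = Fract [:0, 1:] 1"

end

(* A partition is recorded by its Maya diagram, the positions i - lam_i of the vertical steps of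
   its boundary.  Building lam cell by cell and keeping only the cells of a subset D applies the
   0-Hecke generators of the contents of D to the empty partition; the generalized excited
   diagrams of lam/mu are exactly the D whose Demazure product is mu.  Attach a variable y_p to
   every boundary step p and give a cell in the row of step r and the column of step s the weight
   y_r / y_s - 1.  The sums of these weights over the D with product mu (the localizations at lam
   of the K-theoretic Schubert class of mu) satisfy a Chevalley formula: up to a monomial factor,
   the sum for mu equals the sum over all nu obtained by adding a set of addable cells to mu.  It
   follows by induction on lam, because adding a cell acts by a left Demazure operator, which
   intertwines the Chevalley operators for y and for y with two neighbouring variables exchanged.
   At y_p = q^p the weights become q^(-hook) - 1, and the formula turns into the recursion that
   one gets for the sum over increasing tableaux by removing the cells with entry 1. *)
theory Submission
  imports Defs
begin

section \<open>Diagrams and Maya diagrams\<close>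

text \<open>Partitions as down-closed cell sets, so that single cells can be added and removed
  freely. The list encoding returns only in the last part.\<close>

definition diagram :: "cell set \<Rightarrow> bool" where
  "diagram M \<longleftrightarrow> finite M \<and>
     (\<forall>i j. (i, j) \<in> M \<longrightarrow> 1 \<le> i \<and> 1 \<le> j \<and> (\<forall>i' j'. 1 \<le> i' \<longrightarrow> i' \<le> i \<longrightarrow> 1 \<le> j' \<longrightarrow> j' \<le> j \<longrightarrow> (i', j') \<in> M))"

definition row_len :: "cell set \<Rightarrow> nat \<Rightarrow> nat" where
  "row_len M i = card {j. (i, j) \<in> M}"

definition col_len :: "cell set \<Rightarrow> nat \<Rightarrow> nat" where
  "col_len M j = card {i. (i, j) \<in> M}"

definition addable :: "cell set \<Rightarrow> cell \<Rightarrow> bool" where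
  "addable M c \<longleftrightarrow> c \<notin> M \<and> 1 \<le> fst c \<and> 1 \<le> snd c \<and>
     (1 < fst c \<longrightarrow> (fst c - 1, snd c) \<in> M) \<and> (1 < snd c \<longrightarrow> (fst c, snd c - 1) \<in> M)"

text \<open>Contents are row minus column (the usual sign is the opposite), so that adding a cell of content
  \<open>k\<close> moves a boundary step from position \<open>k + 1\<close> to position \<open>k\<close>.\<close>
definition cell_content :: "cell \<Rightarrow> int" where
  "cell_content c = int (fst c) - int (snd c)"

lemma diagram_finite: "diagram M \<Longrightarrow> finite M"
  by (simp add: diagram_def)

lemma diagram_pos: "diagram M \<Longrightarrow> (i, j) \<in> M \<Longrightarrow> 1 \<le> i \<and> 1 \<le> j"
  unfolding diagram_def by blast

lemma diagram_down:
  "diagram M \<Longrightarrow> (i, j) \<in> M \<Longrightarrow> 1 \<le> i' \<Longrightarrow> i' \<le> i \<Longrightarrow> 1 \<le> j' \<Longrightarrow> j' \<le> j \<Longrightarrow> (i', j') \<in> M"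
  unfolding diagram_def by blast

lemma diagram_empty [simp]: "diagram {}"
  by (simp add: diagram_def)

lemma initial_segment_card:
  assumes "finite A" "0 \<notin> A" "\<And>x y. x \<in> A \<Longrightarrow> 1 \<le> y \<Longrightarrow> y \<le> x \<Longrightarrow> y \<in> A"
  shows "A = {1..card A}"
proof (cases "A = {}")
  case False
  have "A = {1..Max A}"
  proof
    show "A \<subseteq> {1..Max A}"
      using assms(1,2) by (auto simp: Suc_le_eq intro!: gr0I)
    show "{1..Max A} \<subseteq> A"
      using assms(3)[of "Max A"] Max_in[OF assms(1) False] by auto
  qed
  then show ?thesis
    by (metis card_atLeastAtMost diff_Suc_1)
qed simp

lemma mem_diagram_row:
  assumes "diagram M"
  shows "(i, j) \<in> M \<longleftrightarrow> 1 \<le> i \<and> 1 \<le> j \<and> j \<le> row_len M i"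
proof -
  have "finite {j. (i, j) \<in> M}"
    using finite_imageI[OF diagram_finite[OF assms], of snd]
    by (rule finite_subset[rotated]) force
  note fin = this
  have *: "{j. (i, j) \<in> M} = {1..row_len M i}"
    unfolding row_len_def
  proof (rule initial_segment_card)
    show "0 \<notin> {j. (i, j) \<in> M}"
      using diagram_pos[OF assms, of i 0] by auto
  next
    fix x y assume "x \<in> {j. (i, j) \<in> M}" "1 \<le> y" "y \<le> x"
    then show "y \<in> {j. (i, j) \<in> M}"
      using diagram_pos[OF assms, of i x] diagram_down[OF assms, of i x i y] by auto
  qed (rule fin)
  have "(i, j) \<in> M \<longleftrightarrow> j \<in> {1..row_len M i}"
    using * by blast
  then show ?thesis
    using diagram_pos[OF assms, of i j] by auto
qed

lemma mem_diagram_col: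
  assumes "diagram M"
  shows "(i, j) \<in> M \<longleftrightarrow> 1 \<le> i \<and> 1 \<le> j \<and> i \<le> col_len M j"
proof -
  have "finite {i. (i, j) \<in> M}"
    using finite_imageI[OF diagram_finite[OF assms], of fst]
    by (rule finite_subset[rotated]) force
  note fin = this
  have *: "{i. (i, j) \<in> M} = {1..col_len M j}"
    unfolding col_len_def
  proof (rule initial_segment_card)
    show "0 \<notin> {i. (i, j) \<in> M}"
      using diagram_pos[OF assms, of 0 j] by auto
  next
    fix x y assume "x \<in> {i. (i, j) \<in> M}" "1 \<le> y" "y \<le> x"
    then show "y \<in> {i. (i, j) \<in> M}"
      using diagram_pos[OF assms, of x j] diagram_down[OF assms, of x j y j] by auto
  qed (rule fin)
  have "(i, j) \<in> M \<longleftrightarrow> i \<in> {1..col_len M j}"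
    using * by blast
  then show ?thesis
    using diagram_pos[OF assms, of i j] by auto
qed

lemma row_len_antimono:
  assumes "diagram M" "1 \<le> i" "i \<le> i'"
  shows "row_len M i' \<le> row_len M i"
  using mem_diagram_row[OF assms(1), of i' "row_len M i'"] mem_diagram_row[OF assms(1), of i "row_len M i'"]
    diagram_down[OF assms(1), of i' "row_len M i'" i "row_len M i'"] assms
  by (cases "row_len M i' = 0") auto

lemma row_len_insert:
  assumes "diagram M" "(i0, j0) \<notin> M"
  shows "row_len (insert (i0, j0) M) i = row_len M i + (if i = i0 then 1 else 0)"
proof -
  have "finite {j. (i, j) \<in> M}"
    using finite_imageI[OF diagram_finite[OF assms(1)], of snd]
    by (rule finite_subset[rotated]) force
  moreover have "{j. (i, j) \<in> insert (i0, j0) M} = (if i = i0 then insert j0 {j. (i, j) \<in> M} else {j. (i, j) \<in> M})"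
    by auto
  ultimately show ?thesis
    using assms(2) by (cases "i = i0") (auto simp: row_len_def)
qed

lemma col_len_insert:
  assumes "diagram M" "(i0, j0) \<notin> M"
  shows "col_len (insert (i0, j0) M) j = col_len M j + (if j = j0 then 1 else 0)"
proof -
  have "finite {i. (i, j) \<in> M}"
    using finite_imageI[OF diagram_finite[OF assms(1)], of fst]
    by (rule finite_subset[rotated]) force
  moreover have "{i. (i, j) \<in> insert (i0, j0) M} = (if j = j0 then insert i0 {i. (i, j) \<in> M} else {i. (i, j) \<in> M})"
    by auto
  ultimately show ?thesis
    using assms(2) by (cases "j = j0") (auto simp: col_len_def)
qed

lemma addable_row_len:
  assumes "diagram M" "addable M (i, j)"
  shows "row_len M i = j - 1" "1 \<le> i" "1 \<le> j"
proof -
  show "1 \<le> i" "1 \<le> j" using assms(2) by (auto simp: addable_def)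
  then show "row_len M i = j - 1"
    using mem_diagram_row[OF assms(1), of i j] mem_diagram_row[OF assms(1), of i "j - 1"] assms(2)
    by (cases "j = 1") (auto simp: addable_def)
qed

lemma addable_col_len:
  assumes "diagram M" "addable M (i, j)"
  shows "col_len M j = i - 1"
  using mem_diagram_col[OF assms(1), of i j] mem_diagram_col[OF assms(1), of "i - 1" j] assms(2)
  by (cases "i = 1") (auto simp: addable_def)

lemma addable_below:
  assumes "diagram M" "addable M (i, j)" "1 \<le> i'" "i' \<le> i" "1 \<le> j'" "j' \<le> j" "(i', j') \<noteq> (i, j)"
  shows "(i', j') \<in> M"
proof (cases "i' = i")
  case True
  then show ?thesis
    using assms diagram_down[OF assms(1), of i "j - 1" i' j'] by (auto simp: addable_def)
next
  case False
  then show ?thesis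
    using assms diagram_down[OF assms(1), of "i - 1" j i' j'] by (auto simp: addable_def)
qed

lemma diagram_insert:
  assumes "diagram M" "addable M c"
  shows "diagram (insert c M)"
proof -
  obtain i j where c: "c = (i, j)" by fastforce
  note below = addable_below[OF assms(1) assms(2)[unfolded c]]
  show ?thesis
    unfolding diagram_def c
  proof (intro conjI allI impI)
    fix a b a' b'
    assume "(a, b) \<in> insert (i, j) M" "1 \<le> a'" "a' \<le> a" "1 \<le> b'" "b' \<le> b"
    then show "(a', b') \<in> insert (i, j) M"
      using below diagram_down[OF assms(1), of a b a' b'] by (cases "(a, b) = (i, j)") auto
  qed (use assms diagram_pos[OF assms(1)] in \<open>auto simp: diagram_finite addable_def c\<close>)
qed

lemma addable_union:
  assumes "diagram M" "addable M c" "\<And>d. d \<in> J \<Longrightarrow> addable M d" "c \<notin> J"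
  shows "addable (M \<union> J) c"
  using assms by (auto simp: addable_def)

lemma diagram_union_addable:
  assumes "diagram M" "finite J" "\<And>d. d \<in> J \<Longrightarrow> addable M d"
  shows "diagram (M \<union> J)"
  using assms(2,3)
proof (induction J)
  case (insert c J)
  have "addable (M \<union> J) c"
    by (rule addable_union) (use insert assms(1) in auto)
  then show ?case
    using diagram_insert insert by auto
qed (use assms in auto)

text \<open>Of two distinct cells on one diagonal, one is strictly northwest of the other, so it
  would already belong to \<open>M\<close> once the other is addable.\<close>

lemma inj_cell_content:
  assumes "diagram M"
  shows "inj_on cell_content {c. addable M c}"
proof (rule inj_onI)
  fix c d
  assume "c \<in> {c. addable M c}" "d \<in> {c. addable M c}" and eq: "cell_content c = cell_content d"
  then have cd: "addable M c" "addable M d" by auto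
  obtain i j i' j' where c: "c = (i, j)" and d: "d = (i', j')" by fastforce
  show "c = d"
  proof (rule ccontr)
    assume "c \<noteq> d"
    then have "i < i' \<and> j < j' \<or> i' < i \<and> j' < j"
      using eq by (auto simp: c d cell_content_def)
    then show False
      using addable_below[OF assms, of i j i' j'] addable_below[OF assms, of i' j' i j] cd
      by (auto simp: c d addable_def)
  qed
qed

lemma diagram_remove:
  assumes M: "diagram M" and b: "(i, j) \<in> M" "(i + 1, j) \<notin> M" "(i, j + 1) \<notin> M"
  shows "diagram (M - {(i, j)})" "addable (M - {(i, j)}) (i, j)"
proof -
  have max: "(i', j') = (i, j)" if "(i', j') \<in> M" "i \<le> i'" "j \<le> j'" for i' j'
    using diagram_down[OF M that(1), of "i + 1" j] diagram_down[OF M that(1), of i "j + 1"]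
      diagram_pos[OF M b(1)] b(2,3) that(2,3) by (cases "i' = i"; cases "j' = j") auto
  show "diagram (M - {(i, j)})"
    unfolding diagram_def
  proof (intro conjI allI impI)
    fix a b' a' b''
    assume "(a, b') \<in> M - {(i, j)}" "1 \<le> a'" "a' \<le> a" "1 \<le> b''" "b'' \<le> b'"
    then show "(a', b'') \<in> M - {(i, j)}"
      using max[of a b'] diagram_down[OF M, of a b' a' b''] by auto
  qed (use diagram_finite[OF M] diagram_pos[OF M] in auto)
  show "addable (M - {(i, j)}) (i, j)"
    using diagram_down[OF M b(1)] diagram_pos[OF M b(1)] by (auto simp: addable_def)
qed

text \<open>Truncation at row \<open>N\<close> keeps the set finite, so that products over it make
  sense; it records all of \<open>M\<close> only if the rows of \<open>M\<close> stop at
  \<open>N\<close>. An empty row \<open>i\<close> sits at position \<open>i\<close>.\<close>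

definition maya :: "nat \<Rightarrow> cell set \<Rightarrow> int set" where
  "maya N M = (\<lambda>i. int i - int (row_len M i)) ` {1..N}"

lemma finite_maya [simp]: "finite (maya N M)"
  by (simp add: maya_def)

lemma maya_le: "maya N M \<subseteq> {..int N}"
  by (auto simp: maya_def)

lemma inj_maya:
  assumes "diagram M"
  shows "inj_on (\<lambda>i. int i - int (row_len M i)) {1..N}"
proof (rule linorder_inj_onI)
  fix i i' :: nat assume "i < i'" "i \<in> {1..N}" "i' \<in> {1..N}"
  then show "int i - int (row_len M i) \<noteq> int i' - int (row_len M i')"
    using row_len_antimono[OF assms, of i i'] by auto
qed auto

text \<open>The new cell lengthens one row by 1, which moves the position of that row from
  \<open>cell_content c + 1\<close> down to \<open>cell_content c\<close> and leaves all other
  positions alone.\<close>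

lemma maya_mem_addable:
  assumes M: "diagram M" and c: "addable M c" and N: "fst c \<le> N"
  shows "cell_content c + 1 \<in> maya N M" "cell_content c \<notin> maya N M"
    "maya N (insert c M) = insert (cell_content c) (maya N M - {cell_content c + 1})"
proof -
  obtain i j where cij: "c = (i, j)" by fastforce
  let ?p = "\<lambda>i. int i - int (row_len M i)"
  note r = addable_row_len[OF M c[unfolded cij]]
  have iN: "i \<in> {1..N}" using r N by (simp add: cij)
  have pi: "?p i = cell_content c + 1"
    using r by (simp add: cij cell_content_def)
  have "?p i \<in> maya N M"
    unfolding maya_def using iN by (rule imageI)
  then show "cell_content c + 1 \<in> maya N M"
    by (simp only: pi)
  show "cell_content c \<notin> maya N M"
  proof
    assume "cell_content c \<in> maya N M"
    then obtain i' where i': "i' \<in> {1..N}" "cell_content c = ?p i'"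
      by (auto simp: maya_def)
    \<comment> \<open>Positions increase with the row, so a row at position
      \<open>cell_content c\<close> would lie above row \<open>i\<close>. But such a row has length
      at least \<open>j\<close>, which puts it below position \<open>i - j\<close>.\<close>
    have lt: "i' < i"
    proof (rule ccontr)
      assume "\<not> i' < i"
      then have "?p i \<le> ?p i'" using row_len_antimono[OF M, of i i'] r by auto
      then show False using pi i' by simp
    qed
    then have "(i', j) \<in> M"
      using addable_below[OF M c[unfolded cij], of i' j] r i' by auto
    then have "j \<le> row_len M i'" using mem_diagram_row[OF M] by blast
    then show False using i'(2) lt by (auto simp: cij cell_content_def)
  qed
  have nc: "(i, j) \<notin> M" using c by (simp add: addable_def cij)
  have "maya N (insert c M) = insert (cell_content c) (?p ` ({1..N} - {i}))"
  proof -
    have "maya N (insert c M) = (\<lambda>i'. int i' - int (row_len (insert c M) i')) ` insert i ({1..N} - {i})"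
      unfolding maya_def using iN by (simp only: insert_Diff)
    also have "\<dots> = insert (int i - int (row_len (insert c M) i)) ((\<lambda>i'. int i' - int (row_len (insert c M) i')) ` ({1..N} - {i}))"
      by (rule image_insert)
    also have "int i - int (row_len (insert c M) i) = cell_content c"
      using pi by (simp add: cij row_len_insert[OF M nc])
    also have "(\<lambda>i'. int i' - int (row_len (insert c M) i')) ` ({1..N} - {i}) = ?p ` ({1..N} - {i})"
      by (rule image_cong) (auto simp: cij row_len_insert[OF M nc])
    finally show ?thesis .
  qed
  also have "?p ` ({1..N} - {i}) = maya N M - {cell_content c + 1}"
    unfolding maya_def using inj_on_image_set_diff[OF inj_maya[OF M, of N], of "{1..N}" "{i}"] iN pi
    by simp
  finally show "maya N (insert c M) = insert (cell_content c) (maya N M - {cell_content c + 1})" .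
qed

definition ascents :: "int set \<Rightarrow> int set" where
  "ascents S = {k. k + 1 \<in> S \<and> k \<notin> S}"

lemma finite_ascents: "finite S \<Longrightarrow> finite (ascents S)"
  by (rule finite_subset[of _ "(\<lambda>x. x - 1) ` S"]) (force simp: ascents_def image_iff)+

text \<open>A free place directly below the position of row \<open>i\<close> means that row
  \<open>i - 1\<close>, if there is one, is strictly longer, so row \<open>i\<close> can be
  extended.\<close>

lemma maya_ascents:
  assumes M: "diagram M"
  shows "bij_betw cell_content {c. addable M c \<and> fst c \<le> N} (ascents (maya N M))"
  unfolding bij_betw_def
proof
  show "inj_on cell_content {c. addable M c \<and> fst c \<le> N}"
    by (rule inj_on_subset[OF inj_cell_content[OF M]]) auto
  show "cell_content ` {c. addable M c \<and> fst c \<le> N} = ascents (maya N M)"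
  proof
    show "cell_content ` {c. addable M c \<and> fst c \<le> N} \<subseteq> ascents (maya N M)"
      using maya_mem_addable[OF M] by (auto simp: ascents_def)
    show "ascents (maya N M) \<subseteq> cell_content ` {c. addable M c \<and> fst c \<le> N}"
    proof
      fix k assume "k \<in> ascents (maya N M)"
      then obtain i where i: "1 \<le> i" "i \<le> N" "k + 1 = int i - int (row_len M i)" and k: "k \<notin> maya N M"
        by (auto simp: ascents_def maya_def)
      let ?c = "(i, row_len M i + 1)"
      have "(i - 1, row_len M i + 1) \<in> M" if "1 < i"
      proof -
        have "row_len M (i - 1) \<noteq> row_len M i"
        proof
          assume "row_len M (i - 1) = row_len M i"
          then have "k = int (i - 1) - int (row_len M (i - 1))"
            using i that by auto
          moreover have "int (i - 1) - int (row_len M (i - 1)) \<in> maya N M"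
            unfolding maya_def using i that by (intro imageI) auto
          ultimately show False using k by metis
        qed
        then have "row_len M i + 1 \<le> row_len M (i - 1)"
          using row_len_antimono[OF M, of "i - 1" i] that by linarith
        then show ?thesis using mem_diagram_row[OF M] that by auto
      qed
      then have "addable M ?c"
        using i mem_diagram_row[OF M] by (auto simp: addable_def)
      moreover have "cell_content ?c = k" using i by (simp add: cell_content_def)
      ultimately show "k \<in> cell_content ` {c. addable M c \<and> fst c \<le> N}"
        using i by (intro image_eqI[of _ _ ?c]) auto
    qed
  qed
qed

text \<open>A free place directly above the position of row \<open>i\<close> means that row
  \<open>i + 1\<close> is strictly shorter. The bound \<open>k < int N\<close> excludes an empty row
  \<open>N\<close>, which has no successor in the truncation and no cell to remove.\<close>

lemma maya_removable:
  assumes M: "diagram M" and "M \<subseteq> {..N} \<times> UNIV" and k: "k \<in> maya N M" "k + 1 \<notin> maya N M" "k < int N"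
  obtains b where "b \<in> M" "cell_content b = k" "diagram (M - {b})" "addable (M - {b}) b"
proof -
  obtain i where i: "1 \<le> i" "i \<le> N" "k = int i - int (row_len M i)"
    using k by (auto simp: maya_def)
  have lt: "row_len M (i + 1) < row_len M i"
  proof (cases "i < N")
    case True
    then have "int (i + 1) - int (row_len M (i + 1)) \<in> maya N M"
      unfolding maya_def by (intro imageI) auto
    then have "k + 1 \<noteq> int (i + 1) - int (row_len M (i + 1))"
      using k(2) by metis
    then show ?thesis
      using i row_len_antimono[OF M, of i "i + 1"] by auto
  next
    case False
    then have "i = N" using i by simp
    then have "(i + 1, row_len M (i + 1)) \<notin> M" using assms(2) by auto
    then have "row_len M (i + 1) = 0"
      using mem_diagram_row[OF M, of "i + 1" "row_len M (i + 1)"] by auto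
    then show ?thesis using i k(3) \<open>i = N\<close> by auto
  qed
  let ?b = "(i, row_len M i)"
  have b: "?b \<in> M" using mem_diagram_row[OF M] i lt by auto
  have "(i + 1, row_len M i) \<notin> M" "(i, row_len M i + 1) \<notin> M"
    using mem_diagram_row[OF M] lt by auto
  note diagram_remove[OF M b this]
  then show ?thesis
    using that[of ?b] b i by (auto simp: cell_content_def)
qed

section \<open>Excited diagrams as fibres of the Demazure product\<close>

text \<open>The generator acts on Maya diagrams; \<open>{}\<close> stands for a product that is no longer a partition.\<close>
definition step :: "int \<Rightarrow> int set \<Rightarrow> int set" where
  "step k S = (if k + 1 \<in> S \<and> k \<notin> S then insert k (S - {k + 1})
     else if k \<in> S \<and> k + 1 \<notin> S then S else {})"

lemma step_idem: "step k (step k S) = step k S"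
  by (auto simp: step_def)

lemma step_commute: "1 < \<bar>k - l\<bar> \<Longrightarrow> step k (step l S) = step l (step k S)"
  by (cases "k \<in> S"; cases "k + 1 \<in> S"; cases "l \<in> S"; cases "l + 1 \<in> S") (auto simp: step_def)

text \<open>The head of the list is the cell added last.\<close>
fun reading :: "cell list \<Rightarrow> bool" where
  "reading [] = True"
| "reading (c # cs) = (reading cs \<and> addable (set cs) c)"

lemma diagram_reading: "reading cs \<Longrightarrow> diagram (set cs)"
  by (induction cs) (auto intro: diagram_insert)

lemma reading_exists: "diagram L \<Longrightarrow> \<exists>cs. reading cs \<and> set cs = L"
proof (induction "card L" arbitrary: L)
  case 0
  then show ?case
    using diagram_finite by (intro exI[of _ "[]"]) auto
next
  case (Suc n)
  then have "finite L" "L \<noteq> {}" using diagram_finite by auto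
  \<comment> \<open>A cell with maximal sum of coordinates is a corner and can be read last.\<close>
  then obtain b where b: "b \<in> L" "\<And>c. c \<in> L \<Longrightarrow> fst c + snd c \<le> fst b + snd b"
    using finite_has_maximal[of "(\<lambda>c. fst c + snd c) ` L"]
    by (smt (verit) finite_imageI image_iff image_is_empty nle_le)
  obtain i j where ij: "b = (i, j)" by fastforce
  have "(i + 1, j) \<notin> L" "(i, j + 1) \<notin> L"
    using b(2)[of "(i + 1, j)"] b(2)[of "(i, j + 1)"] by (auto simp: ij)
  note * = diagram_remove[OF Suc.prems b(1)[unfolded ij] this]
  moreover have "card (L - {(i, j)}) = n"
    using Suc.hyps(2) b(1) \<open>finite L\<close> by (simp add: ij)
  ultimately obtain cs where "reading cs" "set cs = L - {(i, j)}"
    using Suc.hyps(1)[of "L - {(i, j)}"] by auto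
  then show ?case
    using * b(1) by (intro exI[of _ "(i, j) # cs"]) (auto simp: ij)
qed

text \<open>\<open>{1..int N}\<close> is the Maya diagram of the empty partition, to which the
  0-Hecke product of the contents of \<open>D\<close>, taken in reading order, is applied.\<close>

fun demazure :: "nat \<Rightarrow> cell list \<Rightarrow> cell set \<Rightarrow> int set" where
  "demazure N [] D = {1..int N}"
| "demazure N (c # cs) D = (if c \<in> D then step (cell_content c) (demazure N cs D) else demazure N cs D)"

lemma demazure_cong: "(\<And>c. c \<in> set cs \<Longrightarrow> c \<in> D \<longleftrightarrow> c \<in> D') \<Longrightarrow> demazure N cs D = demazure N cs D'"
  by (induction cs) auto

lemma demazure_insert_outside [simp]:
  "c \<notin> set cs \<Longrightarrow> demazure N cs (insert c D) = demazure N cs D"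
  by (rule demazure_cong) auto

lemma demazure_diff_outside [simp]:
  "c \<notin> set cs \<Longrightarrow> demazure N cs (D - {c}) = demazure N cs D"
  by (rule demazure_cong) auto

text \<open>In any reading order, the cells of \<open>D\<close> read between \<open>(i, j)\<close> and \<open>(i + 1, j + 1)\<close> have contents at
  distance at least 2 from that of \<open>(i, j)\<close>, so its generator can be commuted to the end.\<close>
lemma demazure_active:
  assumes "reading cs" "(i, j) \<in> set cs" "(i + 1, j + 1) \<notin> set cs"
    "(i, j) \<in> D" "(i + 1, j) \<notin> D" "(i, j + 1) \<notin> D"
  shows "demazure N cs D = step (cell_content (i, j)) (demazure N cs (D - {(i, j)}))"
  using assms(1-3)
proof (induction cs)
  case (Cons d cs)
  note dgm = diagram_reading[of cs]
  show ?case
  proof (cases "d = (i, j)")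
    case True
    then show ?thesis using Cons.prems assms(4) by (auto simp: addable_def)
  next
    case False
    then have c: "(i, j) \<in> set cs" and c': "(i + 1, j + 1) \<notin> set cs" using Cons.prems by auto
    have IH: "demazure N cs D = step (cell_content (i, j)) (demazure N cs (D - {(i, j)}))"
      using Cons c c' by auto
    show ?thesis
    proof (cases "d \<in> D")
      case True
      obtain a b where d: "d = (a, b)" by fastforce
      have add: "addable (set cs) (a, b)" using Cons.prems by (simp add: d)
      have M: "diagram (set cs)" using Cons.prems dgm by simp
      note pos = diagram_pos[OF M c]
      have nin: "(a, b) \<notin> set cs" using add by (simp add: addable_def)
      \<comment> \<open>A cell that is neither weakly northwest of \<open>(i, j)\<close> nor weakly
        southeast of \<open>(i + 1, j + 1)\<close> has content at distance at least 1 from that of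
        \<open>(i, j)\<close>, with equality only for \<open>(i + 1, j)\<close> and
        \<open>(i, j + 1)\<close>, which are not in \<open>D\<close>.\<close>
      have "\<not> (a \<le> i \<and> b \<le> j)"
        using nin diagram_down[OF M c, of a b] add by (auto simp: addable_def)
      moreover have "\<not> (i + 1 \<le> a \<and> j + 1 \<le> b)"
        using addable_below[OF M add, of "i + 1" "j + 1"] c' Cons.prems(3) by (auto simp: d)
      moreover have "(a, b) \<noteq> (i + 1, j)" "(a, b) \<noteq> (i, j + 1)"
        using True assms(5,6) by (auto simp: d)
      ultimately have "1 < \<bar>cell_content (a, b) - cell_content (i, j)\<bar>"
        by (auto simp: cell_content_def)
      from step_commute[OF this] show ?thesis
        using True False IH by (simp add: d)
    qed (use False IH in auto)
  qed
qed simp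

text \<open>When \<open>(i + 1, j + 1)\<close> is read, \<open>demazure_active\<close> has the
  generator of \<open>(i, j)\<close> as the outermost factor. The two cells have equal content, so
  type I merely postpones this factor and type II repeats it, which idempotence absorbs.\<close>

lemma demazure_moves:
  assumes "reading cs" "(i + 1, j + 1) \<in> set cs" "(i, j) \<in> set cs"
    "(i, j) \<in> D" "(i + 1, j) \<notin> D" "(i, j + 1) \<notin> D" "(i + 1, j + 1) \<notin> D"
  shows "demazure N cs (D - {(i, j)} \<union> {(i + 1, j + 1)}) = demazure N cs D"
    and "demazure N cs (D \<union> {(i + 1, j + 1)}) = demazure N cs D"
proof -
  let ?c = "(i, j)" and ?c' = "(i + 1, j + 1)"
  have "demazure N cs (D - {?c} \<union> {?c'}) = demazure N cs D \<and> demazure N cs (D \<union> {?c'}) = demazure N cs D"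
    using assms(1-3)
  proof (induction cs)
    case (Cons d cs)
    show ?case
    proof (cases "d = ?c'")
      case True
      then have c: "?c \<in> set cs" and c': "?c' \<notin> set cs"
        using Cons.prems by (auto simp: addable_def)
      have act: "demazure N cs D = step (cell_content ?c) (demazure N cs (D - {?c}))"
        using Cons.prems c c' assms by (intro demazure_active) auto
      moreover have "cell_content ?c' = cell_content ?c" by (simp add: cell_content_def)
      moreover have "step (cell_content ?c) (demazure N cs D) = demazure N cs D"
        unfolding act by (rule step_idem)
      ultimately show ?thesis
        using True c' assms(7) by simp
    next
      case False
      then have c': "?c' \<in> set cs" using Cons.prems by auto
      have pos: "1 \<le> i" "1 \<le> j"
        using diagram_pos[OF diagram_reading[OF Cons.prems(1)] Cons.prems(3)] by auto
      have cs: "reading cs" using Cons.prems(1) by simp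
      have c: "?c \<in> set cs"
        by (rule diagram_down[OF diagram_reading[OF cs] c']) (use pos in auto)
      then have "d \<noteq> ?c" using Cons.prems(1) by (auto simp: addable_def)
      then show ?thesis
        using False Cons.IH[OF cs c' c] by simp
    qed
  qed simp
  then show "demazure N cs (D - {?c} \<union> {?c'}) = demazure N cs D"
    and "demazure N cs (D \<union> {?c'}) = demazure N cs D" by auto
qed

lemma maya_empty: "maya N {} = {1..int N}"
proof -
  have "maya N {} = int ` {1..N}" by (auto simp: maya_def row_len_def)
  then show ?thesis by (simp add: image_int_atLeastAtMost)
qed

text \<open>Each cell of \<open>M\<close>, when read, is addable to the part of \<open>M\<close>
  read before it, so every generator acts as a genuine move. In the induction, a last read cell
  lying in \<open>M\<close> is a corner of \<open>M\<close>, since the ambient diagram has no cell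
  southeast of it.\<close>

lemma demazure_diagram:
  assumes "reading cs" "diagram M" "M \<subseteq> set cs" "set cs \<subseteq> {..N} \<times> UNIV"
  shows "demazure N cs M = maya N M"
  using assms
proof (induction cs arbitrary: M)
  case (Cons c cs)
  obtain i j where c: "c = (i, j)" by fastforce
  have L: "diagram (set cs)" using Cons.prems diagram_reading by auto
  show ?case
  proof (cases "c \<in> M")
    case True
    have "(a, b) \<notin> M" if "(a, b) \<noteq> c" "i \<le> a" "j \<le> b" for a b
      using diagram_down[OF L, of a b i j] that Cons.prems by (auto simp: addable_def c)
    then have *: "diagram (M - {c})" "addable (M - {c}) c"
      using diagram_remove[OF Cons.prems(2), of i j] True by (auto simp: c)
    have "demazure N cs M = maya N (M - {c})"
      using Cons.IH[OF _ *(1)] Cons.prems True by (auto simp: addable_def)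
    moreover have "fst c \<le> N" using Cons.prems(4) by (auto simp: c)
    with maya_mem_addable[OF *, of N] have "step (cell_content c) (maya N (M - {c})) = maya N M"
      using True by (simp add: step_def insert_absorb)
    ultimately show ?thesis using True by simp
  next
    case False
    then have "M \<subseteq> set cs" using Cons.prems(3) by auto
    then show ?thesis using False Cons.IH[OF _ Cons.prems(2)] Cons.prems(1,4) by simp
  qed
qed (auto simp: maya_empty)

section \<open>Closure under excited moves versus fibres of the Demazure product\<close>

definition movable :: "cell set \<Rightarrow> cell set \<Rightarrow> cell \<Rightarrow> bool" where
  "movable L S c \<longleftrightarrow> (case c of (i, j) \<Rightarrow> c \<in> S \<and>
     (i + 1, j) \<in> L - S \<and> (i, j + 1) \<in> L - S \<and> (i + 1, j + 1) \<in> L - S)"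

text \<open>\<open>excited\<close> over arbitrary cell sets, so that the ambient diagram can grow by
  one cell in an induction.\<close>

inductive_set exc :: "cell set \<Rightarrow> cell set \<Rightarrow> cell set set" for L M where
  start: "M \<in> exc L M"
| move_I: "S \<in> exc L M \<Longrightarrow> movable L S (i, j) \<Longrightarrow> (S - {(i, j)}) \<union> {(i + 1, j + 1)} \<in> exc L M"
| move_II: "S \<in> exc L M \<Longrightarrow> movable L S (i, j) \<Longrightarrow> S \<union> {(i + 1, j + 1)} \<in> exc L M"

lemma excited_eq_exc: "excited lam mu = exc (young lam) (young mu)"
proof -
  have *: "active lam = movable (young lam)"
    by (intro ext) (simp add: active_def movable_def)
  have "D \<in> exc (young lam) (young mu)" if "D \<in> excited lam mu" for D
    using that by induction (auto simp: * intro: exc.intros[simplified])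
  moreover have "D \<in> excited lam mu" if "D \<in> exc (young lam) (young mu)" for D
    using that by induction (auto simp flip: * intro: excited.intros[simplified])
  ultimately show ?thesis by blast
qed

lemma exc_subset: "D \<in> exc L M \<Longrightarrow> M \<subseteq> L \<Longrightarrow> D \<subseteq> L"
  by (induction rule: exc.induct) (auto simp: movable_def)

lemma exc_mono:
  assumes "D \<in> exc L M" "L \<subseteq> L'"
  shows "D \<in> exc L' M"
  using assms(1)
proof induction
  case (move_I S i j)
  then show ?case using assms(2) by (intro exc.move_I) (auto simp: movable_def)
next
  case (move_II S i j)
  then show ?case using assms(2) by (intro exc.move_II) (auto simp: movable_def)
qed (rule exc.start)

lemma exc_self: "D \<in> exc L L \<Longrightarrow> D = L"
  by (induction rule: exc.induct) (auto simp: movable_def)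

text \<open>Moves inside \<open>L\<close> never involve the outside cell \<open>c\<close>, so a
  chain of them from \<open>M\<close> to \<open>D\<close> can be replayed with \<open>c\<close>
  present, once \<open>insert c M\<close> itself has been reached.\<close>

lemma exc_spectator:
  assumes "D \<in> exc L M" "M \<subseteq> L" "c \<notin> L" "insert c M \<in> exc (insert c L) M0"
  shows "insert c D \<in> exc (insert c L) M0"
  using assms(1)
proof induction
  case (move_I S i j)
  have "S \<subseteq> L" using exc_subset[OF move_I.hyps(1) assms(2)] .
  then have "movable (insert c L) (insert c S) (i, j)" "(i, j) \<noteq> c"
    using move_I assms(3) by (auto simp: movable_def)
  from exc.move_I[OF move_I.IH this(1)] this(2) show ?case
    by (simp add: insert_Diff_if insert_commute)
next
  case (move_II S i j)
  have "movable (insert c L) (insert c S) (i, j)"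
    using move_II assms(3) by (auto simp: movable_def)
  from exc.move_II[OF move_II.IH this] show ?case
    by (simp add: insert_commute)
qed (use assms in simp)

text \<open>A single move of the corner \<open>(i, j)\<close>, of type I or II, creates
  \<open>(i + 1, j + 1)\<close>; type I moves then slide that cell down the diagonal. Nothing blocks
  it, because \<open>M\<close> has no cell southeast of a corner.\<close>

lemma exc_diagonal:
  assumes M: "diagram M" and L: "diagram L" and sub: "M \<subseteq> L"
    and b: "(i, j) \<in> M" "diagram (M - {(i, j)})"
    and t: "(i + Suc t, j + Suc t) \<in> L"
  shows "insert (i + Suc t, j + Suc t) (M - {(i, j)}) \<in> exc L M"
    and "insert (i + Suc t, j + Suc t) M \<in> exc L M"
proof -
  have pos: "1 \<le> i" "1 \<le> j" using diagram_pos[OF M b(1)] by auto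
  have out: "(a, b') \<notin> M" if "i \<le> a" "j \<le> b'" "(a, b') \<noteq> (i, j)" for a b'
    using diagram_down[OF b(2), of a b' i j] that pos by auto
  \<comment> \<open>\<open>X\<close> stands for what remains of \<open>M\<close> after the first
    move: \<open>M - {(i, j)}\<close> for type I, \<open>M\<close> for type II.\<close>
  have slide: "insert (i + Suc t, j + Suc t) X \<in> exc L M"
    if X: "X \<subseteq> M" "insert (i + 1, j + 1) X \<in> exc L M" and tL: "(i + Suc t, j + Suc t) \<in> L" for X t
    using tL
  proof (induction t)
    case (Suc t)
    note dn = diagram_down[OF L Suc.prems]
    have IH: "insert (i + Suc t, j + Suc t) X \<in> exc L M"
      using Suc.IH dn by auto
    have *: "(i + Suc t + 1, j + Suc t) \<in> L" "(i + Suc t, j + Suc t + 1) \<in> L" "(i + Suc t + 1, j + Suc t + 1) \<in> L"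
      using dn Suc.prems by auto
    have **: "(i + Suc t + 1, j + Suc t) \<notin> M" "(i + Suc t, j + Suc t + 1) \<notin> M"
      "(i + Suc t + 1, j + Suc t + 1) \<notin> M" "(i + Suc t, j + Suc t) \<notin> M"
      by (intro out; simp)+
    have "movable L (insert (i + Suc t, j + Suc t) X) (i + Suc t, j + Suc t)"
      using * ** X(1) by (auto simp: movable_def)
    note mv = exc.move_I[OF IH this]
    have "(i + Suc t, j + Suc t) \<notin> X" using **(4) X(1) by blast
    then show ?case using mv by simp
  qed (use X in simp)
  have "movable L M (i, j)"
    using out[of "i + 1" j] out[of i "j + 1"] out[of "i + 1" "j + 1"]
      diagram_down[OF L t] b(1) pos by (auto simp: movable_def)
  from exc.move_I[OF exc.start this] exc.move_II[OF exc.start this]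
  show "insert (i + Suc t, j + Suc t) (M - {(i, j)}) \<in> exc L M"
    and "insert (i + Suc t, j + Suc t) M \<in> exc L M"
    using slide[of "M - {(i, j)}" t] slide[of M t] t by auto
qed

lemma demazure_exc:
  assumes "reading cs" "diagram M" "M \<subseteq> set cs" "set cs \<subseteq> {..N} \<times> UNIV" "D \<in> exc (set cs) M"
  shows "demazure N cs D = maya N M"
  using assms(5)
proof induction
  case start
  then show ?case by (rule demazure_diagram[OF assms(1-4)])
next
  case (move_I S i j)
  then show ?case
    using demazure_moves(1)[OF assms(1), of i j S] exc_subset[OF move_I.hyps(1) assms(3)]
    by (auto simp: movable_def simp del: Un_insert_right)
next
  case (move_II S i j)
  then show ?case
    using demazure_moves(2)[OF assms(1), of i j S] exc_subset[OF move_II.hyps(1) assms(3)]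
    by (auto simp: movable_def simp del: Un_insert_right)
qed

lemma maya_eq_empty_diagram:
  assumes M: "diagram M" "M \<subseteq> {..N} \<times> UNIV" and eq: "maya N M = {1..int N}"
  shows "M = {}"
proof (rule ccontr)
  assume "M \<noteq> {}"
  then obtain i j where ij: "(i, j) \<in> M" by fastforce
  have pos: "1 \<le> i" "1 \<le> j" using diagram_pos[OF M(1) ij] by auto
  then have "(1, 1) \<in> M" using diagram_down[OF M(1) ij] by simp
  then have "1 \<le> row_len M 1" "1 \<le> N"
    using mem_diagram_row[OF M(1), of 1 1] M(2) by auto
  moreover from this have "int 1 - int (row_len M 1) \<in> maya N M"
    unfolding maya_def by (intro imageI) auto
  ultimately show False using eq by auto
qed

text \<open>A nonempty set has at most two preimages under \<open>step k\<close>: itself and the set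
  with \<open>k\<close> moved back to \<open>k + 1\<close>, which for a Maya diagram removes a
  corner of content \<open>k\<close>. With \<open>1 \<le> N\<close> the Maya diagram is nonempty and
  so differs from the failure value \<open>{}\<close>.\<close>

lemma step_eq_maya:
  assumes M: "diagram M" "M \<subseteq> {..N} \<times> UNIV" and k: "k < int N"
    and N: "1 \<le> N" and eq: "step k R = maya N M"
  obtains b where "b \<in> M" "cell_content b = k" "diagram (M - {b})" "addable (M - {b}) b"
    "R = maya N M \<or> R = maya N (M - {b})"
proof -
  have "maya N M \<noteq> {}" using N by (simp add: maya_def)
  then have kM: "k \<in> maya N M" "k + 1 \<notin> maya N M"
    unfolding eq[symmetric] by (auto simp: step_def split: if_splits)
  obtain b where b: "b \<in> M" "cell_content b = k" "diagram (M - {b})" "addable (M - {b}) b"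
    using maya_removable[OF M kM k] .
  have "fst b \<le> N" using b(1) M(2) by auto
  from maya_mem_addable[OF b(3,4) this] have
    *: "k + 1 \<in> maya N (M - {b})" "k \<notin> maya N (M - {b})"
       "maya N M = insert k (maya N (M - {b}) - {k + 1})"
    using b by (simp_all add: insert_absorb)
  have "R = maya N M \<or> R = maya N (M - {b})"
  proof (cases "k + 1 \<in> R \<and> k \<notin> R")
    case True
    then have "insert k (R - {k + 1}) = insert k (maya N (M - {b}) - {k + 1})"
      using eq * by (simp add: step_def)
    moreover have "X = insert (k + 1) (insert k (X - {k + 1}) - {k})" if "k + 1 \<in> X" "k \<notin> X" for X
      using that by auto
    ultimately have "R = maya N (M - {b})"
      using True *(1,2) by metis
    then show ?thesis ..
  next
    case False
    then show ?thesis using eq \<open>maya N M \<noteq> {}\<close> by (auto simp: step_def split: if_splits)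
  qed
  then show ?thesis using b that by blast
qed

text \<open>Induction on the cell \<open>c\<close> read last. If \<open>c\<close> lies in
  \<open>D\<close>, the product before \<open>c\<close> is that of \<open>M\<close> or of
  \<open>M\<close> without a corner \<open>b\<close> of the same content; the moves for
  \<open>D - {c}\<close> are replayed with \<open>c\<close> as spectator, and \<open>c\<close>
  itself comes from \<open>b\<close> along the diagonal. The inclusion of \<open>M\<close> is part
  of the conclusion, which later kills the Chevalley terms leaving \<open>L\<close>.\<close>

lemma exc_demazure:
  assumes "reading cs" "set cs \<subseteq> {..N} \<times> UNIV" "diagram M" "M \<subseteq> {..N} \<times> UNIV"
    "D \<subseteq> set cs" "demazure N cs D = maya N M"
  shows "M \<subseteq> set cs \<and> D \<in> exc (set cs) M"
  using assms
proof (induction cs arbitrary: M D)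
  case Nil
  then have "M = {}" using maya_eq_empty_diagram[of M N] by simp
  then show ?case using Nil by (auto intro: exc.start)
next
  case (Cons c cs)
  let ?L = "set cs"
  have L: "diagram ?L" "diagram (insert c ?L)"
    using Cons.prems(1) diagram_reading[of cs] diagram_insert by auto
  have c: "c \<notin> ?L" "1 \<le> fst c" "1 \<le> snd c" "fst c \<le> N"
    using Cons.prems(1,2) by (auto simp: addable_def)
  have IH: "M' \<subseteq> ?L \<and> D' \<in> exc ?L M'"
    if "diagram M'" "M' \<subseteq> {..N} \<times> UNIV" "D' \<subseteq> ?L" "demazure N cs D' = maya N M'" for M' D'
    using Cons.IH[OF _ _ that] Cons.prems(1,2) by auto
  show ?case
  proof (cases "c \<in> D")
    case False
    then have "M \<subseteq> ?L" "D \<in> exc ?L M"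
      using IH[of M D] Cons.prems by auto
    then show ?thesis
      using exc_mono[of D ?L M "insert c ?L"] by auto
  next
    case True
    let ?D = "D - {c}"
    have D: "?D \<subseteq> ?L" "insert c ?D = D" using Cons.prems(5) True by auto
    have "step (cell_content c) (demazure N cs ?D) = maya N M"
      using Cons.prems(6) True c(1) by simp
    moreover have "cell_content c < int N" "1 \<le> N" using c by (auto simp: cell_content_def)
    ultimately obtain b where b: "b \<in> M" "cell_content b = cell_content c" "diagram (M - {b})" "addable (M - {b}) b"
      and R: "demazure N cs ?D = maya N M \<or> demazure N cs ?D = maya N (M - {b})"
      using step_eq_maya[OF Cons.prems(3,4)] by metis
    have Mb: "M - {b} \<subseteq> ?L"
      using R IH[OF Cons.prems(3,4) D(1)] IH[OF b(3) _ D(1)] Cons.prems(4) by auto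
    obtain i j where bij: "b = (i, j)" by fastforce
    have pos: "1 \<le> i" "1 \<le> j" using diagram_pos[OF Cons.prems(3)] b(1) by (auto simp: bij)
    \<comment> \<open>Otherwise \<open>c\<close>, being on the diagonal of \<open>b\<close>, would
      be strictly northwest of \<open>b\<close> and hence in \<open>M - {b}\<close>, which is
      contained in \<open>?L\<close>.\<close>
    have diag: "b = c \<or> (\<exists>t. c = (i + Suc t, j + Suc t))"
    proof (cases "i < fst c")
      case True
      then have "c = (i + Suc (fst c - i - 1), j + Suc (fst c - i - 1))"
        using b(2) pos c by (cases c) (auto simp: bij cell_content_def)
      then show ?thesis by blast
    next
      case False
      have "c \<in> M - {b}" if "b \<noteq> c"
        using addable_below[OF b(3), of i j "fst c" "snd c"] b(2,4) that c False
        by (cases c) (auto simp: bij cell_content_def)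
      then show ?thesis using Mb c(1) by blast
    qed
    have bL: "b \<in> insert c ?L"
      using diag diagram_down[OF L(2), of "fst c" "snd c" i j] pos by (auto simp: bij)
    have MsubL: "M \<subseteq> insert c ?L" using Mb bL by auto
    have "D \<in> exc (insert c ?L) M"
      using R
    proof
      \<comment> \<open>The generator of \<open>c\<close> was absorbed, so \<open>c\<close> is a
        copy of \<open>b\<close> made by a type II move.\<close>
      assume *: "demazure N cs ?D = maya N M"
      then have **: "M \<subseteq> ?L" "?D \<in> exc ?L M" using IH[OF Cons.prems(3,4) D(1)] by auto
      then obtain t where "c = (i + Suc t, j + Suc t)" using diag b(1) c(1) by auto
      then have "insert c M \<in> exc (insert c ?L) M"
        using exc_diagonal(2)[OF Cons.prems(3) L(2) MsubL b(1)[unfolded bij] b(3)[unfolded bij]] by auto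
      from exc_spectator[OF **(2,1) c(1) this] show ?thesis using D by simp
    next
      \<comment> \<open>The generator of \<open>c\<close> added the corner \<open>b\<close>, so
        \<open>c\<close> is \<open>b\<close> itself or \<open>b\<close> moved by type I.\<close>
      assume *: "demazure N cs ?D = maya N (M - {b})"
      then have **: "?D \<in> exc ?L (M - {b})" using IH[OF b(3) _ D(1)] Cons.prems(4) by auto
      have "insert c (M - {b}) \<in> exc (insert c ?L) M"
      proof (cases "b = c")
        case True
        then show ?thesis using b(1) exc.start by (simp add: insert_absorb)
      next
        case False
        then obtain t where "c = (i + Suc t, j + Suc t)" using diag by auto
        then show ?thesis
          using exc_diagonal(1)[OF Cons.prems(3) L(2) MsubL b(1)[unfolded bij] b(3)[unfolded bij]]
          by (auto simp: bij)
      qed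
      from exc_spectator[OF ** Mb c(1) this] show ?thesis using D by simp
    qed
    then show ?thesis using MsubL by simp
  qed
qed

lemma exc_eq_demazure_fiber:
  assumes "reading cs" "diagram M" "M \<subseteq> set cs" "set cs \<subseteq> {..N} \<times> UNIV"
  shows "exc (set cs) M = {D. D \<subseteq> set cs \<and> demazure N cs D = maya N M}"
  using demazure_exc[OF assms] exc_subset[OF _ assms(3)] exc_demazure[OF assms(1,4,2)] assms(3,4)
  by blast

section \<open>The Chevalley formula\<close>

text \<open>The denominator uses the position of the horizontal boundary step of the column; these
  positions are the ones not taken by rows.\<close>

definition cell_weight :: "cell set \<Rightarrow> (int \<Rightarrow> 'a) \<Rightarrow> cell \<Rightarrow> 'a::field" where
  "cell_weight L y c = y (int (fst c) - int (row_len L (fst c))) / y (int (col_len L (snd c)) - int (snd c) + 1) - 1"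

definition swap_vars :: "int \<Rightarrow> (int \<Rightarrow> 'a) \<Rightarrow> int \<Rightarrow> 'a" where
  "swap_vars k y = y(k := y (k + 1), k + 1 := y k)"

text \<open>Adding \<open>c\<close> of content \<open>k\<close> moves its row from position
  \<open>k + 1\<close> to \<open>k\<close> and its column from \<open>k\<close> to
  \<open>k + 1\<close>; no other row or column occupies either position.\<close>

lemma cell_weight_insert:
  assumes L: "diagram L" and c: "addable L c" and d: "d \<in> L"
  shows "cell_weight (insert c L) y d = cell_weight L (swap_vars (cell_content c) y) d"
proof -
  obtain i j where cij: "c = (i, j)" by fastforce
  obtain a b where dab: "d = (a, b)" by fastforce
  note c' = c[unfolded cij] and d' = d[unfolded dab]
  note pos = diagram_pos[OF L d'] and r = addable_row_len[OF L c'] and s = addable_col_len[OF L c']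
  have nin: "(i, j) \<notin> L" using c' by (simp add: addable_def)
  let ?r = "\<lambda>L. int a - int (row_len L a)" and ?s = "\<lambda>L. int (col_len L b) - int b + 1"
  have row: "y (?r (insert c L)) = swap_vars (cell_content c) y (?r L)"
  proof (cases a i rule: linorder_cases)
    case less
    then have "j \<le> row_len L a"
      using addable_below[OF L c', of a j] mem_diagram_row[OF L, of a j] pos r by auto
    then show ?thesis
      using less by (simp add: cij swap_vars_def cell_content_def row_len_insert[OF L nin])
  next
    case equal
    then show ?thesis
      using r by (simp add: cij swap_vars_def cell_content_def row_len_insert[OF L nin])
  next
    case greater
    then have "row_len L a < j"
      using diagram_down[OF L, of a j i j] mem_diagram_row[OF L, of a j] pos r nin by force
    then show ?thesis
      using greater by (simp add: cij swap_vars_def cell_content_def row_len_insert[OF L nin])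
  qed
  have col: "y (?s (insert c L)) = swap_vars (cell_content c) y (?s L)"
  proof (cases b j rule: linorder_cases)
    case less
    then have "i \<le> col_len L b"
      using addable_below[OF L c', of i b] mem_diagram_col[OF L, of i b] pos r by auto
    then show ?thesis
      using less by (simp add: cij swap_vars_def cell_content_def col_len_insert[OF L nin])
  next
    case equal
    then show ?thesis
      using r s by (simp add: cij swap_vars_def cell_content_def col_len_insert[OF L nin])
  next
    case greater
    then have "col_len L b < i"
      using diagram_down[OF L, of i b i j] mem_diagram_col[OF L, of i b] pos r nin by force
    then show ?thesis
      using greater by (simp add: cij swap_vars_def cell_content_def col_len_insert[OF L nin])
  qed
  show ?thesis
    using row col by (simp add: cell_weight_def dab)
qed

lemma cell_weight_new:
  assumes L: "diagram L" and c: "addable L c"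
  shows "cell_weight (insert c L) y c = y (cell_content c) / y (cell_content c + 1) - 1"
proof -
  obtain i j where cij: "c = (i, j)" by fastforce
  note c' = c[unfolded cij]
  note r = addable_row_len[OF L c'] and s = addable_col_len[OF L c']
  have nin: "(i, j) \<notin> L" using c' by (simp add: addable_def)
  have "int i - int (row_len (insert c L) i) = cell_content c" "int (col_len (insert c L) j) - int j + 1 = cell_content c + 1"
    using r s by (auto simp: cij cell_content_def row_len_insert[OF L nin] col_len_insert[OF L nin])
  then show ?thesis by (simp add: cell_weight_def cij)
qed

text \<open>The product runs over \<open>D\<close>, whereas the theorem has the complement;
  \<open>excited_sum_localization\<close> converts between the two at the cost of a common
  factor.\<close>

definition localization :: "nat \<Rightarrow> cell list \<Rightarrow> (int \<Rightarrow> 'a) \<Rightarrow> int set \<Rightarrow> 'a::field" where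
  "localization N cs y S = (\<Sum>D | D \<subseteq> set cs \<and> demazure N cs D = S. \<Prod>c\<in>D. cell_weight (set cs) y c)"

lemma step_eq_iff:
  assumes "S \<noteq> {}"
  shows "step k R = S \<longleftrightarrow> k \<in> S \<and> k + 1 \<notin> S \<and> (R = S \<or> R = insert (k + 1) (S - {k}))"
proof
  assume "step k R = S"
  then show "k \<in> S \<and> k + 1 \<notin> S \<and> (R = S \<or> R = insert (k + 1) (S - {k}))"
    using assms by (auto simp: step_def split: if_splits)
next
  assume "k \<in> S \<and> k + 1 \<notin> S \<and> (R = S \<or> R = insert (k + 1) (S - {k}))"
  then show "step k R = S"
    by (auto simp: step_def)
qed

text \<open>Split by whether \<open>c\<close> belongs to \<open>D\<close>. The old cells keep their
  weights up to exchanging two variables, and \<open>step_eq_iff\<close> lists the products possible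
  before \<open>c\<close>. The right-hand side is the left Demazure operator.\<close>

lemma localization_Cons:
  fixes y :: "int \<Rightarrow> 'a::field"
  assumes rd: "reading (c # cs)" and S: "S \<noteq> {}" and k: "k = cell_content c"
  shows "localization N (c # cs) y S = localization N cs (swap_vars k y) S +
    (if k \<in> S \<and> k + 1 \<notin> S
     then (y k / y (k + 1) - 1) * (localization N cs (swap_vars k y) S +
        localization N cs (swap_vars k y) (insert (k + 1) (S - {k}))) else 0)"
proof -
  let ?L = "set cs" and ?y = "swap_vars k y" and ?S' = "insert (k + 1) (S - {k})"
  have L: "diagram ?L" and add: "addable ?L c" and c: "c \<notin> ?L"
    using rd diagram_reading[of cs] by (auto simp: addable_def)
  let ?F = "\<lambda>S. {D. D \<subseteq> ?L \<and> demazure N cs D = S}"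
  let ?G = "{D. D \<subseteq> ?L \<and> step k (demazure N cs D) = S}"
  let ?p = "\<lambda>D. \<Prod>c\<in>D. cell_weight ?L ?y c"
  let ?P = "\<lambda>D. \<Prod>d\<in>D. cell_weight (insert c ?L) y d"
  have fin: "finite {D. D \<subseteq> ?L \<and> Q D}" for Q
    by (rule finite_subset[of _ "Pow ?L"]) auto
  have P: "?P D = ?p D" if "D \<subseteq> ?L" for D
    using that by (intro prod.cong) (auto simp: k cell_weight_insert[OF L add])
  have P': "?P (insert c D) = (y k / y (k + 1) - 1) * ?p D" if "D \<subseteq> ?L" for D
  proof -
    have "finite D" "c \<notin> D" using that c finite_subset by auto
    then show ?thesis using P[OF that] by (simp add: k cell_weight_new[OF L add])
  qed
  have split: "{D. D \<subseteq> insert c ?L \<and> demazure N (c # cs) D = S} = ?F S \<union> insert c ` ?G"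
  proof
    show "{D. D \<subseteq> insert c ?L \<and> demazure N (c # cs) D = S} \<subseteq> ?F S \<union> insert c ` ?G"
    proof
      fix D assume D: "D \<in> {D. D \<subseteq> insert c ?L \<and> demazure N (c # cs) D = S}"
      show "D \<in> ?F S \<union> insert c ` ?G"
      proof (cases "c \<in> D")
        case True
        then have "D = insert c (D - {c})" "D - {c} \<in> ?G" using D c by (auto simp: k)
        then show ?thesis by blast
      qed (use D in auto)
    qed
    show "?F S \<union> insert c ` ?G \<subseteq> {D. D \<subseteq> insert c ?L \<and> demazure N (c # cs) D = S}"
      using c by (auto simp: k)
  qed
  have inj: "inj_on (insert c) ?G"
  proof (rule inj_onI)
    fix D D' assume "D \<in> ?G" "D' \<in> ?G" "insert c D = insert c D'"
    then show "D = D'" using c by (metis (no_types, lifting) insert_ident mem_Collect_eq subsetD)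
  qed
  have "localization N (c # cs) y S = (\<Sum>D\<in>?F S \<union> insert c ` ?G. ?P D)"
    unfolding localization_def split[symmetric] by simp
  also have "\<dots> = (\<Sum>D\<in>?F S. ?P D) + (\<Sum>D\<in>insert c ` ?G. ?P D)"
    using c by (intro sum.union_disjoint finite_imageI fin) auto
  also have "(\<Sum>D\<in>?F S. ?P D) = localization N cs ?y S"
    unfolding localization_def by (intro sum.cong) (auto simp: P)
  also have "(\<Sum>D\<in>insert c ` ?G. ?P D) = (\<Sum>D\<in>?G. ?P (insert c D))"
    by (simp add: sum.reindex[OF inj] o_def)
  also have "\<dots> = (y k / y (k + 1) - 1) * (\<Sum>D\<in>?G. ?p D)"
    unfolding sum_distrib_left by (intro sum.cong) (auto simp: P')
  also have "(\<Sum>D\<in>?G. ?p D) = (if k \<in> S \<and> k + 1 \<notin> S then localization N cs ?y S + localization N cs ?y ?S' else 0)"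
  proof (cases "k \<in> S \<and> k + 1 \<notin> S")
    case True
    then have "?G = ?F S \<union> ?F ?S'" by (auto simp: step_eq_iff[OF S])
    moreover have "?F S \<inter> ?F ?S' = {}" using True by auto
    ultimately show ?thesis
      using True by (simp add: localization_def sum.union_disjoint fin)
  next
    case False
    then have G: "?G = {}" by (auto simp: step_eq_iff[OF S])
    from False show ?thesis unfolding G by auto
  qed
  finally show ?thesis by simp
qed

section \<open>Monomial factors, moves of boundary steps, and induction over the cells\<close>

definition wt :: "(int \<Rightarrow> 'a) \<Rightarrow> int set \<Rightarrow> 'a::field" where
  "wt y S = (\<Prod>p\<in>S. y p)"

lemma wt_swap_vars:
  assumes "finite S"
  shows "k \<in> S \<longleftrightarrow> k + 1 \<in> S \<Longrightarrow> wt (swap_vars k y) S = wt y S"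
    and "k + 1 \<in> S \<Longrightarrow> k \<notin> S \<Longrightarrow> wt (swap_vars k y) S = wt y (insert k (S - {k + 1}))"
    and "k \<in> S \<Longrightarrow> k + 1 \<notin> S \<Longrightarrow> wt (swap_vars k y) S = wt y (insert (k + 1) (S - {k}))"
proof -
  let ?R = "S - {k, k + 1}"
  have R: "wt (swap_vars k y) ?R = wt y ?R"
    unfolding wt_def by (intro prod.cong) (auto simp: swap_vars_def)
  have fin: "finite ?R" using assms by simp
  show "wt (swap_vars k y) S = wt y S" if "k \<in> S \<longleftrightarrow> k + 1 \<in> S"
  proof (cases "k \<in> S")
    case True
    then have S: "S = insert k (insert (k + 1) ?R)" using that by auto
    have "wt z S = z k * (z (k + 1) * wt z ?R)" for z :: "int \<Rightarrow> 'a"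
      unfolding wt_def by (subst S) (use fin in simp)
    then show ?thesis using R by (simp add: swap_vars_def)
  next
    case False
    then have "?R = S" using that by auto
    then show ?thesis using R by simp
  qed
  show "wt (swap_vars k y) S = wt y (insert k (S - {k + 1}))" if "k + 1 \<in> S" "k \<notin> S"
  proof -
    have "S = insert (k + 1) ?R" "insert k (S - {k + 1}) = insert k ?R" using that by auto
    then have "wt (swap_vars k y) S = swap_vars k y (k + 1) * wt (swap_vars k y) ?R"
      "wt y (insert k (S - {k + 1})) = y k * wt y ?R"
      unfolding wt_def using fin by (metis Diff_iff insertI1 insertI2 insert_commute prod.insert)+
    then show ?thesis using R by (simp add: swap_vars_def)
  qed
  show "wt (swap_vars k y) S = wt y (insert (k + 1) (S - {k}))" if "k \<in> S" "k + 1 \<notin> S"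
  proof -
    have "S = insert k ?R" "insert (k + 1) (S - {k}) = insert (k + 1) ?R" using that by auto
    then have "wt (swap_vars k y) S = swap_vars k y k * wt (swap_vars k y) ?R"
      "wt y (insert (k + 1) (S - {k})) = y (k + 1) * wt y ?R"
      unfolding wt_def using fin by (metis Diff_iff insertI1 insertI2 insert_commute prod.insert)+
    then show ?thesis using R by (simp add: swap_vars_def)
  qed
qed

text \<open>For \<open>J\<close> inside \<open>ascents S\<close> the moves do not interact:
  \<open>k\<close> in \<open>J\<close> needs \<open>k + 1\<close> in \<open>S\<close>, whereas
  \<open>k + 1\<close> in \<open>J\<close> forbids it.\<close>

definition shift :: "int set \<Rightarrow> int set \<Rightarrow> int set" where
  "shift S J = (S - (\<lambda>k. k + 1) ` J) \<union> J"

lemma mem_shift: "p \<in> shift S J \<longleftrightarrow> p \<in> S \<and> p - 1 \<notin> J \<or> p \<in> J"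
  by (force simp: shift_def)

lemma sum_Pow_insert:
  assumes "finite A" "a \<notin> A"
  shows "(\<Sum>J\<in>Pow (insert a A). g J) = (\<Sum>J\<in>Pow A. g J + g (insert a J))"
proof -
  have inj: "inj_on (insert a) (Pow A)"
    using assms(2) by (intro inj_onI) (metis PowD insert_ident subsetD)
  have "(\<Sum>J\<in>Pow (insert a A). g J) = (\<Sum>J\<in>Pow A. g J) + (\<Sum>J\<in>insert a ` Pow A. g J)"
    unfolding Pow_insert using assms by (intro sum.union_disjoint) auto
  then show ?thesis
    by (simp add: sum.reindex[OF inj] o_def sum.distrib)
qed

text \<open>\<open>\<psi>\<close> and \<open>\<psi>'\<close> are the localizations before and after adding a cell of content \<open>k\<close>.\<close>
lemma chevalley_step:
  fixes \<psi> \<psi>' :: "int set \<Rightarrow> 'a::field"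
  assumes y: "y k \<noteq> 0" "y (k + 1) \<noteq> 0" and S: "finite S" "S \<noteq> {}"
    and \<psi>': "\<And>T. T \<noteq> {} \<Longrightarrow> \<psi>' T = \<psi> T + (if k \<in> T \<and> k + 1 \<notin> T
       then (y k / y (k + 1) - 1) * (\<psi> T + \<psi> (insert (k + 1) (T - {k}))) else 0)"
    and ih: "C * \<psi> S = wt (swap_vars k y) S * (\<Sum>J\<in>Pow (ascents S). \<psi> (shift S J))"
    and ih': "\<And>T. k \<in> S \<Longrightarrow> k + 1 \<notin> S \<Longrightarrow> T = insert (k + 1) (S - {k}) \<Longrightarrow>
       C * \<psi> T = wt (swap_vars k y) T * (\<Sum>J\<in>Pow (ascents T). \<psi> (shift T J))"
  shows "C * \<psi>' S = wt y S * (\<Sum>J\<in>Pow (ascents S). \<psi>' (shift S J))"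
proof -
  let ?w = "y k / y (k + 1) - 1"
  have fin: "finite (ascents S)" using S(1) by (rule finite_ascents)
  have ne: "shift S J \<noteq> {}" for J using S(2) by (auto simp: shift_def)
  consider (same) "k \<in> S \<longleftrightarrow> k + 1 \<in> S" | (up) "k \<notin> S" "k + 1 \<in> S" | (down) "k \<in> S" "k + 1 \<notin> S" by blast
  then show ?thesis
  proof cases
    case same
    \<comment> \<open>Neither \<open>k\<close> nor \<open>k + 1\<close> can be made to differ:
      \<open>k\<close> is not an ascent, so no shift ends with \<open>k\<close> occupied and
      \<open>k + 1\<close> free.\<close>
    have "\<psi>' (shift S J) = \<psi> (shift S J)" if "J \<subseteq> ascents S" for J
    proof -
      have "\<not> (k \<in> shift S J \<and> k + 1 \<notin> shift S J)"
        using that same by (auto simp: mem_shift ascents_def)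
      then show ?thesis using \<psi>'[OF ne] by auto
    qed
    then have "(\<Sum>J\<in>Pow (ascents S). \<psi>' (shift S J)) = (\<Sum>J\<in>Pow (ascents S). \<psi> (shift S J))"
      by (intro sum.cong) auto
    moreover have "\<psi>' S = \<psi> S" using \<psi>'[OF S(2)] same by auto
    ultimately show ?thesis using ih wt_swap_vars(1)[OF S(1) same] by metis
  next
    case up
    \<comment> \<open>Here \<open>k\<close> is an ascent, and each \<open>J\<close> avoiding it is
      paired with \<open>insert k J\<close>. Every pair sum acquires the factor
      \<open>1 + ?w = y k / y (k + 1)\<close>, which is also the change of the monomial.\<close>
    let ?A = "ascents S - {k}"
    have A: "insert k (ascents S) = ascents S" using up by (auto simp: ascents_def)
    have k1: "k + 1 \<notin> ascents S" using up by (simp add: ascents_def)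
    have "\<psi>' (shift S J) + \<psi>' (shift S (insert k J)) = (1 + ?w) * (\<psi> (shift S J) + \<psi> (shift S (insert k J)))"
      if "J \<subseteq> ?A" for J
    proof -
      have J: "k \<notin> J" "k + 1 \<notin> J" "k - 1 \<notin> J"
        using that k1 up by (auto simp: ascents_def)
      have 1: "k \<notin> shift S J" using up J by (simp add: mem_shift)
      have 2: "k \<in> shift S (insert k J)" "k + 1 \<notin> shift S (insert k J)"
        using up J by (simp_all add: mem_shift)
      have 3: "insert (k + 1) (shift S (insert k J) - {k}) = shift S J"
        using up J by (auto simp: mem_shift)
      show ?thesis using \<psi>'[OF ne] 1 2 3 by (simp add: algebra_simps)
    qed
    then have "(\<Sum>J\<in>Pow ?A. \<psi>' (shift S J) + \<psi>' (shift S (insert k J)))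
        = (1 + ?w) * (\<Sum>J\<in>Pow ?A. \<psi> (shift S J) + \<psi> (shift S (insert k J)))"
      unfolding sum_distrib_left by (intro sum.cong) auto
    then have "(\<Sum>J\<in>Pow (ascents S). \<psi>' (shift S J)) = (1 + ?w) * (\<Sum>J\<in>Pow (ascents S). \<psi> (shift S J))"
      using sum_Pow_insert[of ?A k "\<lambda>J. \<psi>' (shift S J)"] sum_Pow_insert[of ?A k "\<lambda>J. \<psi> (shift S J)"] fin
      by (simp add: A)
    moreover have "wt (swap_vars k y) S = (1 + ?w) * wt y S"
    proof -
      let ?R = "S - {k + 1}"
      have "S = insert (k + 1) ?R" using up by auto
      then have "wt y S = y (k + 1) * wt y ?R" unfolding wt_def
        using S(1) by (metis Diff_iff finite_Diff insertI1 prod.insert)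
      moreover have "wt y (insert k ?R) = y k * wt y ?R"
        using up S(1) by (simp add: wt_def)
      ultimately show ?thesis using wt_swap_vars(2)[OF S(1) up(2,1), of y] y by (simp add: field_simps)
    qed
    moreover have "\<psi>' S = \<psi> S" using \<psi>'[OF S(2)] up by auto
    ultimately show ?thesis using ih by (simp add: mult_ac)
  next
    case down
    \<comment> \<open>Undoing the move at \<open>k\<close> makes \<open>k\<close> an ascent of
      \<open>T\<close>. The other ascents of \<open>T\<close> are those of \<open>S\<close> that
      disturb neither \<open>k\<close> nor \<open>k + 1\<close>: \<open>k - 1\<close> would vacate
      \<open>k\<close>, and \<open>k + 1\<close> would fill it.\<close>
    define T where "T = insert (k + 1) (S - {k})"
    let ?O = "ascents S - {k - 1, k + 1}"
    have T: "ascents T = insert k ?O" using down by (auto simp: ascents_def T_def)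
    have kO: "k \<notin> ?O" using down by (simp add: ascents_def)
    let ?P = "\<Sum>J\<in>Pow ?O. \<psi> (shift S J)" and ?Q = "\<Sum>J\<in>Pow ?O. \<psi> (shift T J)"
    have "\<psi> (shift T (insert k J)) = \<psi> (shift S J)" if "J \<subseteq> ?O" for J
    proof -
      have J: "k \<notin> J" "k + 1 \<notin> J" "k - 1 \<notin> J" using that kO by auto
      have "shift T (insert k J) = shift S J"
        using down J by (auto simp: mem_shift T_def)
      then show ?thesis by simp
    qed
    then have "(\<Sum>J\<in>Pow (ascents T). \<psi> (shift T J)) = (\<Sum>J\<in>Pow ?O. \<psi> (shift T J) + \<psi> (shift S J))"
      unfolding T using sum_Pow_insert[of ?O k "\<lambda>J. \<psi> (shift T J)"] fin kO by simp
    then have sumT: "(\<Sum>J\<in>Pow (ascents T). \<psi> (shift T J)) = ?P + ?Q"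
      by (simp add: sum.distrib)
    \<comment> \<open>The correction term survives exactly when the shift keeps \<open>k\<close>
      occupied and \<open>k + 1\<close> free, that is, for \<open>J\<close> inside
      \<open>?O\<close>.\<close>
    have "\<psi>' (shift S J) = \<psi> (shift S J) + (if J \<in> Pow ?O then ?w * (\<psi> (shift S J) + \<psi> (shift T J)) else 0)"
      if "J \<subseteq> ascents S" for J
    proof -
      have kJ: "k \<notin> J" using that down by (auto simp: ascents_def)
      then have iff: "k \<in> shift S J \<and> k + 1 \<notin> shift S J \<longleftrightarrow> J \<in> Pow ?O"
        using that down by (auto simp: mem_shift)
      have "insert (k + 1) (shift S J - {k}) = shift T J" if "J \<in> Pow ?O"
        using that kJ down by (auto simp: mem_shift T_def)
      then show ?thesis using \<psi>'[OF ne, of J] iff by simp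
    qed
    then have "(\<Sum>J\<in>Pow (ascents S). \<psi>' (shift S J)) = (\<Sum>J\<in>Pow (ascents S). \<psi> (shift S J)) +
        (\<Sum>J\<in>Pow (ascents S). if J \<in> Pow ?O then ?w * (\<psi> (shift S J) + \<psi> (shift T J)) else 0)"
      unfolding sum.distrib[symmetric] by (intro sum.cong) auto
    also have "(\<Sum>J\<in>Pow (ascents S). if J \<in> Pow ?O then ?w * (\<psi> (shift S J) + \<psi> (shift T J)) else 0)
        = (\<Sum>J\<in>Pow (ascents S) \<inter> Pow ?O. ?w * (\<psi> (shift S J) + \<psi> (shift T J)))"
      using fin by (intro sum.inter_restrict[symmetric]) simp
    also have "Pow (ascents S) \<inter> Pow ?O = Pow ?O" by auto
    also have "(\<Sum>J\<in>Pow ?O. ?w * (\<psi> (shift S J) + \<psi> (shift T J))) = ?w * (?P + ?Q)"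
      by (simp only: sum_distrib_left[symmetric] sum.distrib)
    finally have sumS: "(\<Sum>J\<in>Pow (ascents S). \<psi>' (shift S J)) = (\<Sum>J\<in>Pow (ascents S). \<psi> (shift S J)) + ?w * (?P + ?Q)" .
    have wtS: "wt y S = (1 + ?w) * wt (swap_vars k y) S"
    proof -
      let ?R = "S - {k}"
      have "S = insert k ?R" using down by auto
      then have "wt y S = y k * wt y ?R" unfolding wt_def
        using S(1) by (metis Diff_iff finite_Diff insertI1 prod.insert)
      moreover have "wt y (insert (k + 1) ?R) = y (k + 1) * wt y ?R"
        using down S(1) by (simp add: wt_def)
      ultimately show ?thesis using wt_swap_vars(3)[OF S(1) down, of y] y by (simp add: field_simps)
    qed
    have "insert k (T - {k + 1}) = S" using down by (auto simp: T_def)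
    then have wtT: "wt (swap_vars k y) T = wt y S"
      using wt_swap_vars(2)[of T k y] S(1) down by (simp add: T_def)
    have alg: "C * (a + w * (a + b)) = (1 + w) * (C * a) + w * (C * b)" for a b w
      by (simp add: algebra_simps)
    have "\<psi>' S = \<psi> S + ?w * (\<psi> S + \<psi> T)"
      using \<psi>'[OF S(2)] down by (simp add: T_def)
    then have "C * \<psi>' S = (1 + ?w) * (C * \<psi> S) + ?w * (C * \<psi> T)"
      by (simp only: alg)
    \<comment> \<open>Both instances of the formula, for \<open>S\<close> and for \<open>T\<close>,
      now carry the same monomial: the factor \<open>1 + ?w\<close> turns the swapped weight of
      \<open>S\<close> into \<open>wt y S\<close>, and the swapped weight of \<open>T\<close> equals
      it already.\<close>
    also have "\<dots> = wt y S * (\<Sum>J\<in>Pow (ascents S). \<psi> (shift S J)) + ?w * (wt y S * (?P + ?Q))"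
      unfolding ih ih'[OF down T_def] wtT sumT wtS by (simp only: mult.assoc)
    also have "\<dots> = wt y S * (\<Sum>J\<in>Pow (ascents S). \<psi>' (shift S J))"
      unfolding sumS by (simp only: distrib_left mult.left_commute)
    finally show ?thesis .
  qed
qed

text \<open>Without the bound \<open>S \<subseteq> {..int N}\<close> the formula already fails for the empty partition: a step could move
  from position \<open>N + 1\<close> to position \<open>N\<close>.\<close>
lemma chevalley:
  fixes y :: "int \<Rightarrow> 'a::field"
  assumes "reading cs" "set cs \<subseteq> {..N} \<times> UNIV" "\<And>p. y p \<noteq> 0"
    "finite S" "S \<noteq> {}" "S \<subseteq> {..int N}"
  shows "wt y (maya N (set cs)) * localization N cs y S =
    wt y S * (\<Sum>J\<in>Pow (ascents S). localization N cs y (shift S J))"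
  using assms
proof (induction cs arbitrary: y S)
  case Nil
  have loc: "localization N [] y T = (if T = {1..int N} then 1 else 0)" for T
    by (cases "T = {1..int N}") (auto simp: localization_def intro!: sum.neutral)
  \<comment> \<open>A shift by \<open>p\<close> leaves \<open>p\<close> occupied and
    \<open>p + 1\<close> free, where \<open>p + 1\<close> is at most \<open>N\<close> by the bound
    on \<open>S\<close>; an interval ending at \<open>N\<close> has no such gap.\<close>
  have *: "J = {}" if "J \<subseteq> ascents S" "shift S J = {1..int N}" for J
  proof (rule ccontr)
    assume "J \<noteq> {}"
    then obtain p where p: "p \<in> J" by blast
    then have asc: "p + 1 \<in> S" "p + 1 \<notin> J" using that(1) by (auto simp: ascents_def)
    then have "p + 1 \<notin> shift S J" using p by (simp add: mem_shift)
    moreover have "p \<in> shift S J" using p by (simp add: mem_shift)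
    moreover have "p + 1 \<le> int N" using asc(1) Nil.prems by auto
    ultimately show False unfolding that(2) by auto
  qed
  have "(\<Sum>J\<in>Pow (ascents S). localization N [] y (shift S J)) = (\<Sum>J\<in>{{}}. localization N [] y (shift S J))"
    using * finite_ascents[OF Nil.prems(4)] by (intro sum.mono_neutral_right) (auto simp: loc)
  also have "\<dots> = localization N [] y S" by (simp add: shift_def)
  finally show ?case by (simp add: loc maya_empty)
next
  case (Cons c cs)
  let ?L = "set cs" and ?k = "cell_content c"
  let ?y = "swap_vars ?k y"
  have rd: "reading cs" and add: "addable ?L c" using Cons.prems by auto
  have L: "diagram ?L" using diagram_reading[OF rd] .
  have c: "fst c \<le> N" "1 \<le> snd c" using Cons.prems(2) add by (auto simp: addable_def)
  have y: "?y p \<noteq> 0" for p using Cons.prems(3) by (simp add: swap_vars_def)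
  note IH = Cons.IH[OF rd _ y]
  \<comment> \<open>Moving a boundary step from \<open>?k + 1\<close> to \<open>?k\<close> is
    compensated by exchanging the variables, so the left factor stays constant.\<close>
  have C: "wt y (maya N (insert c ?L)) = wt ?y (maya N ?L)"
    using maya_mem_addable[OF L add c(1)] wt_swap_vars(2)[of "maya N ?L" ?k y] by simp
  have "wt ?y (maya N ?L) * localization N (c # cs) y S =
      wt y S * (\<Sum>J\<in>Pow (ascents S). localization N (c # cs) y (shift S J))"
  proof (rule chevalley_step)
    show "localization N (c # cs) y T = localization N cs ?y T + (if ?k \<in> T \<and> ?k + 1 \<notin> T
       then (y ?k / y (?k + 1) - 1) * (localization N cs ?y T + localization N cs ?y (insert (?k + 1) (T - {?k}))) else 0)"
      if "T \<noteq> {}" for T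
      using localization_Cons[OF Cons.prems(1) that refl] .
    show "wt ?y (maya N ?L) * localization N cs ?y S = wt ?y S * (\<Sum>J\<in>Pow (ascents S). localization N cs ?y (shift S J))"
      using Cons.prems by (intro IH) auto
    fix T assume T: "T = insert (?k + 1) (S - {?k})"
    \<comment> \<open>Keeps \<open>T\<close> within the bound: the row of \<open>c\<close> is at
      most \<open>N\<close> and its column at least 1.\<close>
    have "?k + 1 \<le> int N" using c by (auto simp: cell_content_def)
    then show "wt ?y (maya N ?L) * localization N cs ?y T = wt ?y T * (\<Sum>J\<in>Pow (ascents T). localization N cs ?y (shift T J))"
      using Cons.prems by (intro IH) (auto simp: T)
  qed (use Cons.prems in auto)
  then show ?case using C by simp
qed

lemma maya_union_addable:
  assumes "diagram M" "finite J" "J \<subseteq> {c. addable M c \<and> fst c \<le> N}"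
  shows "maya N (M \<union> J) = shift (maya N M) (cell_content ` J)"
  using assms(2,3)
proof (induction J)
  case empty
  then show ?case by (simp add: shift_def)
next
  case (insert c J)
  have dgm: "diagram (M \<union> J)"
    using insert assms(1) by (intro diagram_union_addable) auto
  have add: "addable (M \<union> J) c"
    using insert assms(1) by (intro addable_union) auto
  have asc: "cell_content ` insert c J \<subseteq> ascents (maya N M)"
    using maya_ascents[OF assms(1), of N] insert.prems by (auto simp: bij_betw_def)
  then have "cell_content c + 1 \<notin> cell_content ` J"
    by (force simp: ascents_def)
  moreover have "maya N (M \<union> insert c J) = insert (cell_content c) (shift (maya N M) (cell_content ` J) - {cell_content c + 1})"
    using maya_mem_addable(3)[OF dgm add] insert by simp
  ultimately show ?case by (auto simp: shift_def)
qed

text \<open>Ascents become addable cells in the first \<open>N\<close> rows. Sets \<open>J\<close>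
  leaving \<open>set cs\<close> contribute 0, since by \<open>exc_demazure\<close> no
  \<open>D\<close> has a product outside \<open>set cs\<close>.\<close>

lemma chevalley_diagram:
  fixes y :: "int \<Rightarrow> 'a::field"
  assumes rd: "reading cs" and rows: "set cs \<subseteq> {..N} \<times> UNIV" "1 \<le> N" and y: "\<And>p. y p \<noteq> 0"
    and M: "diagram M" "M \<subseteq> set cs"
  shows "wt y (maya N (set cs)) * localization N cs y (maya N M) =
    wt y (maya N M) * (\<Sum>J\<in>Pow {c \<in> set cs. addable M c}. localization N cs y (maya N (M \<union> J)))"
proof -
  let ?A = "{c. addable M c \<and> fst c \<le> N}"
  have bij: "bij_betw cell_content ?A (ascents (maya N M))" by (rule maya_ascents[OF M(1)])
  then have fin: "finite ?A" using bij_betw_finite finite_ascents finite_maya by blast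
  have "(\<Sum>J\<in>Pow (ascents (maya N M)). localization N cs y (shift (maya N M) J))
      = (\<Sum>J\<in>Pow ?A. localization N cs y (shift (maya N M) (cell_content ` J)))"
    by (rule sum.reindex_bij_betw[OF bij_betw_Pow[OF bij], symmetric])
  also have "\<dots> = (\<Sum>J\<in>Pow ?A. localization N cs y (maya N (M \<union> J)))"
  proof (intro sum.cong refl)
    fix J assume "J \<in> Pow ?A"
    then show "localization N cs y (shift (maya N M) (cell_content ` J)) = localization N cs y (maya N (M \<union> J))"
      using maya_union_addable[OF M(1), of J N] finite_subset[OF _ fin, of J] by auto
  qed
  also have "\<dots> = (\<Sum>J\<in>Pow {c \<in> set cs. addable M c}. localization N cs y (maya N (M \<union> J)))"
  proof (rule sum.mono_neutral_right)
    show "Pow {c \<in> set cs. addable M c} \<subseteq> Pow ?A" using rows by auto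
    show "\<forall>J\<in>Pow ?A - Pow {c \<in> set cs. addable M c}. localization N cs y (maya N (M \<union> J)) = 0"
    proof
      fix J assume J: "J \<in> Pow ?A - Pow {c \<in> set cs. addable M c}"
      then have "finite J" using finite_subset[OF _ fin] by auto
      then have "diagram (M \<union> J)" "M \<union> J \<subseteq> {..N} \<times> UNIV"
        using J M rows by (auto intro: diagram_union_addable)
      moreover have "\<not> M \<union> J \<subseteq> set cs" using J by auto
      ultimately have "{D. D \<subseteq> set cs \<and> demazure N cs D = maya N (M \<union> J)} = {}"
        using exc_demazure[OF rd rows(1)] by blast
      then show "localization N cs y (maya N (M \<union> J)) = 0"
        unfolding localization_def by (simp only: sum.empty)
    qed
  qed (use fin in simp)
  finally show ?thesis
    using chevalley[OF rd rows(1) y finite_maya _ maya_le, of M] rows(2) by (simp add: maya_def)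
qed

section \<open>Increasing tableaux\<close>

definition tableaux :: "cell set \<Rightarrow> (cell \<Rightarrow> nat) set" where
  "tableaux A = {T. (\<forall>c. c \<notin> A \<longrightarrow> T c = 0)
     \<and> (\<forall>i j j'. (i, j) \<in> A \<longrightarrow> (i, j') \<in> A \<longrightarrow> j < j' \<longrightarrow> T (i, j) < T (i, j'))
     \<and> (\<forall>i i' j. (i, j) \<in> A \<longrightarrow> (i', j) \<in> A \<longrightarrow> i < i' \<longrightarrow> T (i, j) < T (i', j))
     \<and> (\<exists>m. T ` A = {1..m})}"

text \<open>Counting from \<open>k = 0\<close>, the condition \<open>k < T c\<close> says that the
  entry is at least \<open>k + 1\<close>. For \<open>x n = q ^ n / (1 - q ^ n)\<close> the
  numerators multiply to \<open>q\<close> to the sum of the entries.\<close>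

definition tableau_weight :: "(nat \<Rightarrow> 'a) \<Rightarrow> cell set \<Rightarrow> (cell \<Rightarrow> nat) \<Rightarrow> 'a::comm_monoid_mult" where
  "tableau_weight x A T = (\<Prod>k<card (T ` A). x (card {c \<in> A. k < T c}))"

lemma tableauxD:
  assumes "T \<in> tableaux A"
  shows "c \<notin> A \<Longrightarrow> T c = 0"
    and "(i, j) \<in> A \<Longrightarrow> (i, j') \<in> A \<Longrightarrow> j < j' \<Longrightarrow> T (i, j) < T (i, j')"
    and "(i, j) \<in> A \<Longrightarrow> (i', j) \<in> A \<Longrightarrow> i < i' \<Longrightarrow> T (i, j) < T (i', j)"
    and "\<exists>m. T ` A = {1..m}"
proof -
  note T = assms[unfolded tableaux_def mem_Collect_eq]
  show "c \<notin> A \<Longrightarrow> T c = 0" using T[THEN conjunct1] by iprover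
  show "(i, j) \<in> A \<Longrightarrow> (i, j') \<in> A \<Longrightarrow> j < j' \<Longrightarrow> T (i, j) < T (i, j')"
    using T[THEN conjunct2, THEN conjunct1] by iprover
  show "(i, j) \<in> A \<Longrightarrow> (i', j) \<in> A \<Longrightarrow> i < i' \<Longrightarrow> T (i, j) < T (i', j)"
    using T[THEN conjunct2, THEN conjunct2, THEN conjunct1] by iprover
  show "\<exists>m. T ` A = {1..m}"
    by (rule T[THEN conjunct2, THEN conjunct2, THEN conjunct2])
qed

lemma tableauxI:
  assumes "\<And>c. c \<notin> A \<Longrightarrow> T c = 0"
    and "\<And>i j j'. (i, j) \<in> A \<Longrightarrow> (i, j') \<in> A \<Longrightarrow> j < j' \<Longrightarrow> T (i, j) < T (i, j')"
    and "\<And>i i' j. (i, j) \<in> A \<Longrightarrow> (i', j) \<in> A \<Longrightarrow> i < i' \<Longrightarrow> T (i, j) < T (i', j)"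
    and "T ` A = {1..m}"
  shows "T \<in> tableaux A"
  unfolding tableaux_def mem_Collect_eq using assms by iprover

lemma finite_tableaux:
  assumes "finite A"
  shows "finite (tableaux A)"
proof (rule finite_subset)
  show "tableaux A \<subseteq> {T. \<forall>c. (c \<in> A \<longrightarrow> T c \<in> {..card A}) \<and> (c \<notin> A \<longrightarrow> T c = 0)}"
  proof
    fix T assume T: "T \<in> tableaux A"
    then obtain m where m: "T ` A = {1..m}" using tableauxD(4) by blast
    then have "m \<le> card A" using card_image_le[OF assms, of T] by simp
    then have "T c \<le> card A" if "c \<in> A" for c
      using imageI[OF that, of T] m by simp
    then show "T \<in> {T. \<forall>c. (c \<in> A \<longrightarrow> T c \<in> {..card A}) \<and> (c \<notin> A \<longrightarrow> T c = 0)}"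
      using tableauxD(1)[OF T] by simp
  qed
  show "finite {T. \<forall>c. (c \<in> A \<longrightarrow> T c \<in> {..card A}) \<and> (c \<notin> A \<longrightarrow> T c = (0::nat))}"
    using assms by (intro finite_set_of_finite_funs) auto
qed

lemma tableaux_pos:
  assumes "T \<in> tableaux A" "c \<in> A"
  shows "1 \<le> T c"
proof -
  obtain m where "T ` A = {1..m}" using tableauxD(4)[OF assms(1)] by blast
  then show ?thesis using imageI[OF assms(2), of T] by simp
qed

text \<open>A cell with entry 1 has no neighbour above or to the left within the skew shape, hence
  is addable to \<open>M\<close>. The remaining entries are at least 2 and drop by 1.\<close>

lemma tableaux_peel:
  assumes M: "diagram M" "M \<subseteq> L" "M \<noteq> L" and L: "diagram L" and T: "T \<in> tableaux (L - M)"
  defines "J \<equiv> {c. T c = 1}"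
  shows "J \<subseteq> {c \<in> L. addable M c}" "J \<noteq> {}" "(\<lambda>c. T c - 1) \<in> tableaux (L - (M \<union> J))"
proof -
  let ?A = "L - M"
  have T0: "T c = 0" if "c \<notin> ?A" for c using tableauxD(1)[OF T that] .
  note pos = tableaux_pos[OF T] and less = tableauxD(2,3)[OF T]
  have JA: "J \<subseteq> ?A" using T0 by (auto simp: J_def intro: ccontr)
  show "J \<subseteq> {c \<in> L. addable M c}"
  proof
    fix c assume c: "c \<in> J"
    obtain i j where cij: "c = (i, j)" by fastforce
    have ij: "(i, j) \<in> L" "(i, j) \<notin> M" "T (i, j) = 1" using c JA by (auto simp: cij J_def)
    have ge: "1 \<le> i" "1 \<le> j" using diagram_pos[OF L ij(1)] by auto
    have "(i - 1, j) \<in> M" if "1 < i"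
    proof (rule ccontr)
      assume "(i - 1, j) \<notin> M"
      then have "(i - 1, j) \<in> ?A" using diagram_down[OF L ij(1), of "i - 1" j] that ge by auto
      then show False using less(2)[of "i - 1" j i] pos[of "(i - 1, j)"] ij that by auto
    qed
    moreover have "(i, j - 1) \<in> M" if "1 < j"
    proof (rule ccontr)
      assume "(i, j - 1) \<notin> M"
      then have "(i, j - 1) \<in> ?A" using diagram_down[OF L ij(1), of i "j - 1"] that ge by auto
      then show False using less(1)[of i "j - 1" j] pos[of "(i, j - 1)"] ij that by auto
    qed
    ultimately show "c \<in> {c \<in> L. addable M c}" using ij ge by (auto simp: addable_def cij)
  qed
  obtain m where m: "T ` ?A = {1..m}" using tableauxD(4)[OF T] by blast
  have "?A \<noteq> {}" using M by auto
  then have m1: "1 \<le> m" using m by (cases m) auto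
  then have "1 \<in> T ` ?A" using m by simp
  then obtain c where "T c = 1" by force
  then show "J \<noteq> {}" unfolding J_def by blast
  have ge2: "2 \<le> T c" if "c \<in> L - (M \<union> J)" for c
    using that pos[of c] by (auto simp: J_def)
  have "(\<lambda>c. T c - 1) ` (L - (M \<union> J)) = {1..m - 1}"
  proof
    show "(\<lambda>c. T c - 1) ` (L - (M \<union> J)) \<subseteq> {1..m - 1}"
    proof
      fix k assume "k \<in> (\<lambda>c. T c - 1) ` (L - (M \<union> J))"
      then obtain c where c: "c \<in> L - (M \<union> J)" "k = T c - 1" by blast
      then have "T c \<in> {1..m}" using m by blast
      then show "k \<in> {1..m - 1}" using c ge2[OF c(1)] by auto
    qed
    show "{1..m - 1} \<subseteq> (\<lambda>c. T c - 1) ` (L - (M \<union> J))"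
    proof
      fix k assume k: "k \<in> {1..m - 1}"
      then have "k + 1 \<in> T ` ?A" using m by auto
      then obtain c where "c \<in> ?A" "T c = k + 1" by auto
      then show "k \<in> (\<lambda>c. T c - 1) ` (L - (M \<union> J))"
        using k by (intro image_eqI[of _ _ c]) (auto simp: J_def)
    qed
  qed
  moreover have "T c - 1 = 0" if "c \<notin> L - (M \<union> J)" for c
    using T0[of c] that by (auto simp: J_def)
  moreover have "T c - 1 < T d - 1" if "c \<in> L - (M \<union> J)" "T c < T d" for c d
    using ge2[OF that(1)] that(2) by auto
  ultimately show "(\<lambda>c. T c - 1) \<in> tableaux (L - (M \<union> J))"
    using less by (intro tableauxI[where m = "m - 1"]) auto
qed

lemma tableaux_lift:
  assumes M: "diagram M" and J: "J \<subseteq> {c \<in> L. addable M c}" "J \<noteq> {}"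
    and L: "diagram L" and T: "T \<in> tableaux (L - (M \<union> J))"
  defines "T' \<equiv> \<lambda>c. if c \<in> L - M then Suc (T c) else 0"
  shows "T' \<in> tableaux (L - M)" "{c. T' c = 1} = J"
    "tableau_weight x (L - M) T' = x (card (L - M)) * tableau_weight x (L - (M \<union> J)) T"
proof -
  let ?A = "L - M" and ?B = "L - (M \<union> J)"
  have T0: "T c = 0" if "c \<notin> ?B" for c using tableauxD(1)[OF T that] .
  note pos = tableaux_pos[OF T] and less = tableauxD(2,3)[OF T]
  have JA: "J \<subseteq> ?A" using J by (auto simp: addable_def)
  show J1: "{c. T' c = 1} = J"
    using JA T0 pos by (fastforce simp: T'_def split: if_splits)
  obtain m where m: "T ` ?B = {1..m}" using tableauxD(4)[OF T] by blast
  have "?A = J \<union> ?B" using JA by auto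
  then have "T' ` ?A = T' ` J \<union> T' ` ?B" by (metis image_Un)
  also have "T' ` J = {1}" using J1 J(2) by auto
  also have "T' ` ?B = Suc ` T ` ?B" by (force simp: T'_def image_image)
  also have "{1} \<union> Suc ` T ` ?B = {1..Suc m}" unfolding m by (auto simp: image_Suc_atLeastAtMost)
  finally have m': "T' ` ?A = {1..Suc m}" .
  have step: "T' c < T' d" if "c \<in> ?A" "d \<in> ?A" "d \<notin> J" "c \<notin> J \<Longrightarrow> T c < T d" for c d
  proof (cases "c \<in> J")
    case True
    then show ?thesis using that T0[of c] pos[of d] by (auto simp: T'_def)
  next
    case False
    then show ?thesis using that by (auto simp: T'_def)
  qed
  \<comment> \<open>Everything strictly northwest of an addable cell lies in \<open>M\<close>, so a
    cell of \<open>J\<close> never has to exceed another skew cell.\<close>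
  have notJ: "(a, b) \<notin> J" if "(i, j) \<in> ?A" "i \<le> a" "j \<le> b" "(i, j) \<noteq> (a, b)" for a b i j
    using addable_below[OF M, of a b i j] that J diagram_pos[OF L, of i j] by blast
  show "T' \<in> tableaux ?A"
  proof (rule tableauxI)
    fix i j j' assume "(i, j) \<in> ?A" "(i, j') \<in> ?A" "j < j'"
    then show "T' (i, j) < T' (i, j')"
      using notJ[of i j i j'] less(1)[of i j j'] by (intro step) auto
  next
    fix i i' j assume "(i, j) \<in> ?A" "(i', j) \<in> ?A" "i < i'"
    then show "T' (i, j) < T' (i', j)"
      using notJ[of i j i' j] less(2)[of i j i'] by (intro step) auto
  next
    show "T' ` ?A = {1..Suc m}" by (rule m')
  qed (auto simp: T'_def)
  \<comment> \<open>Raising all entries shifts the levels by one; the new level 0 contains every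
    cell and yields the extra factor.\<close>
  have "{c \<in> ?A. Suc k < T' c} = {c \<in> ?B. k < T c}" for k
    using T0 by (force simp: T'_def)
  moreover have "{c \<in> ?A. 0 < T' c} = ?A" by (auto simp: T'_def)
  ultimately show "tableau_weight x ?A T' = x (card ?A) * tableau_weight x ?B T"
    unfolding tableau_weight_def m' m by (simp add: prod.lessThan_Suc_shift del: prod.lessThan_Suc)
qed

lemma tableaux_recursion:
  fixes x :: "nat \<Rightarrow> 'a::comm_semiring_1"
  assumes M: "diagram M" "M \<subseteq> L" "M \<noteq> L" and L: "diagram L"
  shows "(\<Sum>T\<in>tableaux (L - M). tableau_weight x (L - M) T) =
    x (card (L - M)) * (\<Sum>J\<in>Pow {c \<in> L. addable M c} - {{}}.
      \<Sum>T\<in>tableaux (L - (M \<union> J)). tableau_weight x (L - (M \<union> J)) T)"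
proof -
  let ?P = "Pow {c \<in> L. addable M c} - {{}}"
  let ?lift = "\<lambda>T c. if c \<in> L - M then Suc (T c) else 0"
  have fL: "finite L" using L by (rule diagram_finite)
  have "(\<Sum>T\<in>tableaux (L - M). tableau_weight x (L - M) T) =
      (\<Sum>(J, T)\<in>Sigma ?P (\<lambda>J. tableaux (L - (M \<union> J))). x (card (L - M)) * tableau_weight x (L - (M \<union> J)) T)"
  proof (rule sum.reindex_bij_witness[where j = "\<lambda>T. ({c. T c = 1}, \<lambda>c. T c - 1)" and i = "\<lambda>(J, T). ?lift T"])
    fix T assume T: "T \<in> tableaux (L - M)"
    note peel = tableaux_peel[OF M L T]
    have lift: "?lift (\<lambda>c. T c - 1) = T"
    proof
      fix c
      show "?lift (\<lambda>c. T c - 1) c = T c"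
        using tableaux_pos[OF T, of c] tableauxD(1)[OF T, of c] by auto
    qed
    then show "(case ({c. T c = 1}, \<lambda>c. T c - 1) of (J, T) \<Rightarrow> ?lift T) = T" by (simp only: prod.case)
    show "({c. T c = 1}, \<lambda>c. T c - 1) \<in> Sigma ?P (\<lambda>J. tableaux (L - (M \<union> J)))"
      using peel by auto
    show "(case ({c. T c = 1}, \<lambda>c. T c - 1) of (J, T) \<Rightarrow> x (card (L - M)) * tableau_weight x (L - (M \<union> J)) T)
        = tableau_weight x (L - M) T"
      using tableaux_lift(3)[OF M(1) peel(1,2) L peel(3), of x] by (simp only: lift prod.case)
  next
    fix b assume b: "b \<in> Sigma ?P (\<lambda>J. tableaux (L - (M \<union> J)))"
    then obtain J T where JT: "b = (J, T)" "J \<subseteq> {c \<in> L. addable M c}" "J \<noteq> {}" "T \<in> tableaux (L - (M \<union> J))"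
      by blast
    note lift = tableaux_lift[OF M(1) JT(2,3) L JT(4)]
    show "(case b of (J, T) \<Rightarrow> ?lift T) \<in> tableaux (L - M)" using lift(1) JT(1) by simp
    have "(\<lambda>c. ?lift T c - 1) = T"
    proof
      fix c
      show "?lift T c - 1 = T c" using tableauxD(1)[OF JT(4), of c] by auto
    qed
    then show "({c. (case b of (J, T) \<Rightarrow> ?lift T) c = 1}, \<lambda>c. (case b of (J, T) \<Rightarrow> ?lift T) c - 1) = b"
      using lift(2) JT(1) by simp
  qed
  also have "\<dots> = (\<Sum>J\<in>?P. \<Sum>T\<in>tableaux (L - (M \<union> J)). x (card (L - M)) * tableau_weight x (L - (M \<union> J)) T)"
    using fL by (intro sum.Sigma[symmetric]) (auto intro: finite_tableaux)
  finally show ?thesis by (simp add: sum_distrib_left)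
qed

section \<open>Specialization to hook lengths\<close>

text \<open>Each added cell lowers one position by 1, which divides the monomial by
  \<open>q\<close>.\<close>

lemma wt_maya_reading:
  fixes q :: "'a::field"
  assumes "q \<noteq> 0" "reading cs" "set cs \<subseteq> {..N} \<times> UNIV"
  shows "wt (\<lambda>p. q powi p) (maya N (set cs)) * q ^ card (set cs) = wt (\<lambda>p. q powi p) (maya N {})"
  using assms(2,3)
proof (induction cs)
  case (Cons c cs)
  let ?R = "maya N (set cs) - {cell_content c + 1}"
  have "diagram (set cs)" "addable (set cs) c" "fst c \<le> N" "c \<notin> set cs"
    using Cons.prems diagram_reading by (auto simp: addable_def)
  note m = maya_mem_addable[OF this(1-3)]
  have "maya N (set cs) = insert (cell_content c + 1) ?R" using m by auto
  then have "wt (\<lambda>p. q powi p) (maya N (set cs)) = q powi (cell_content c + 1) * wt (\<lambda>p. q powi p) ?R"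
    unfolding wt_def by (metis Diff_iff finite_Diff finite_maya insertI1 prod.insert)
  moreover have "wt (\<lambda>p. q powi p) (maya N (set (c # cs))) = q powi cell_content c * wt (\<lambda>p. q powi p) ?R"
    using m by (simp add: wt_def)
  ultimately show ?case
    using Cons \<open>c \<notin> set cs\<close> assms(1) by (simp add: power_int_add mult_ac)
qed simp

lemma wt_maya_ratio:
  fixes q :: "'a::field"
  assumes q: "q \<noteq> 0" and L: "diagram L" "L \<subseteq> {..N} \<times> UNIV" and M: "diagram M" "M \<subseteq> L"
  shows "wt (\<lambda>p. q powi p) (maya N M) = q ^ card (L - M) * wt (\<lambda>p. q powi p) (maya N L)"
proof -
  have *: "wt (\<lambda>p. q powi p) (maya N K) * q ^ card K = wt (\<lambda>p. q powi p) (maya N {})"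
    if "diagram K" "K \<subseteq> L" for K
    using reading_exists[OF that(1)] wt_maya_reading[OF q, of _ N] that(2) L(2) by (metis subset_trans)
  have "finite L" using L by (simp add: diagram_finite)
  then have "card L = card (L - M) + card M"
    using M(2) by (metis card_Diff_subset card_mono finite_subset le_add_diff_inverse2)
  then have "wt (\<lambda>p. q powi p) (maya N M) * q ^ card M =
      q ^ card (L - M) * wt (\<lambda>p. q powi p) (maya N L) * q ^ card M"
    using *[OF M] *[OF L(1)] by (simp add: power_add mult_ac)
  then show ?thesis using q by simp
qed

definition hook_len :: "cell set \<Rightarrow> cell \<Rightarrow> nat" where
  "hook_len L c = (row_len L (fst c) - snd c) + (col_len L (snd c) - fst c) + 1"

text \<open>The two boundary steps that end the arm and the leg of a cell are a hook length apart,
  the row step at the smaller position.\<close>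

lemma cell_weight_powi:
  fixes q :: "'a::field"
  assumes "q \<noteq> 0" "diagram L" "c \<in> L"
  shows "cell_weight L (\<lambda>p. q powi p) c = (1 - q ^ hook_len L c) / q ^ hook_len L c"
proof -
  obtain i j where c: "c = (i, j)" by fastforce
  have "j \<le> row_len L i" "i \<le> col_len L j"
    using assms(3) mem_diagram_row[OF assms(2)] mem_diagram_col[OF assms(2)] by (auto simp: c)
  then have h: "int i - int (row_len L i) - (int (col_len L j) - int j + 1) = - int (hook_len L c)"
    by (simp add: hook_len_def c)
  have "cell_weight L (\<lambda>p. q powi p) c = q powi (- int (hook_len L c)) - 1"
    unfolding cell_weight_def c fst_conv snd_conv h[symmetric, unfolded c]
    by (subst power_int_diff) (use assms in auto)
  then show ?thesis using assms(1) by (simp add: power_int_minus field_simps)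
qed

definition excited_sum :: "(nat \<Rightarrow> 'a) \<Rightarrow> cell set \<Rightarrow> cell set \<Rightarrow> 'a::comm_semiring_1" where
  "excited_sum x L M = (\<Sum>D\<in>exc L M. \<Prod>c\<in>L - D. x (hook_len L c))"

text \<open>The hook factor is the inverse of the cell weight, so a product of weights over
  \<open>D\<close> is the product over all cells times the hook factors of the complement.\<close>

lemma excited_sum_localization:
  fixes q :: "'a::field"
  assumes q: "q \<noteq> 0" "\<And>n. 0 < n \<Longrightarrow> q ^ n \<noteq> 1"
    and rd: "reading cs" and rows: "set cs \<subseteq> {..N} \<times> UNIV" and M: "diagram M" "M \<subseteq> set cs"
  shows "localization N cs (\<lambda>p. q powi p) (maya N M) =
    (\<Prod>c\<in>set cs. cell_weight (set cs) (\<lambda>p. q powi p) c) * excited_sum (\<lambda>n. q ^ n / (1 - q ^ n)) (set cs) M"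
proof -
  let ?L = "set cs" and ?w = "cell_weight (set cs) (\<lambda>p. q powi p)"
  let ?x = "\<lambda>c. q ^ hook_len ?L c / (1 - q ^ hook_len ?L c)"
  have inv: "?w c * ?x c = 1" if "c \<in> ?L" for c
  proof -
    have "q ^ hook_len ?L c \<noteq> 1" using q(2)[of "hook_len ?L c"] by (simp add: hook_len_def)
    then show ?thesis
      using cell_weight_powi[OF q(1) diagram_reading[OF rd] that] q(1) by simp
  qed
  have split: "(\<Prod>c\<in>D. ?w c) = (\<Prod>c\<in>?L. ?w c) * (\<Prod>c\<in>?L - D. ?x c)" if "D \<subseteq> ?L" for D
  proof -
    have "(\<Prod>c\<in>?L. ?w c) * (\<Prod>c\<in>?L - D. ?x c) = (\<Prod>c\<in>D. ?w c) * ((\<Prod>c\<in>?L - D. ?w c) * (\<Prod>c\<in>?L - D. ?x c))"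
      using prod.subset_diff[OF that, of ?w] by (simp add: mult_ac)
    also have "(\<Prod>c\<in>?L - D. ?w c) * (\<Prod>c\<in>?L - D. ?x c) = 1"
      unfolding prod.distrib[symmetric] by (intro prod.neutral ballI inv) simp
    finally show ?thesis by simp
  qed
  show ?thesis
    unfolding localization_def excited_sum_def sum_distrib_left exc_eq_demazure_fiber[OF rd M rows, symmetric]
    by (intro sum.cong refl split exc_subset[OF _ M(2)])
qed

text \<open>The Chevalley formula at \<open>y p = q powi p\<close>: the product of all weights
  cancels, and the ratio of the two monomials is \<open>q ^ card (L - M)\<close>.\<close>

lemma excited_sum_recursion:
  fixes q :: "'a::field"
  assumes q: "q \<noteq> 0" "\<And>n. 0 < n \<Longrightarrow> q ^ n \<noteq> 1"
    and L: "diagram L" and M: "diagram M" "M \<subseteq> L"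
  defines "x \<equiv> \<lambda>n. q ^ n / (1 - q ^ n)"
  shows "excited_sum x L M = q ^ card (L - M) * (\<Sum>J\<in>Pow {c \<in> L. addable M c}. excited_sum x L (M \<union> J))"
proof -
  obtain cs where cs: "reading cs" "set cs = L" using reading_exists[OF L] by blast
  have fL: "finite L" using L by (rule diagram_finite)
  then obtain N0 where "fst ` L \<subseteq> {..N0}" using finite_nat_iff_bounded_le by blast
  then obtain N where rows: "L \<subseteq> {..N} \<times> UNIV" and N: "1 \<le> N"
    by (intro that[of "Suc N0"]) force+
  let ?y = "\<lambda>p. q powi p"
  let ?W = "\<Prod>c\<in>L. cell_weight L ?y c"
  have W: "?W \<noteq> 0"
  proof -
    have "cell_weight L ?y c \<noteq> 0" if "c \<in> L" for c
      using q(2)[of "hook_len L c"] q(1) unfolding cell_weight_powi[OF q(1) L that] by (simp add: hook_len_def)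
    then show ?thesis using fL by simp
  qed
  have loc: "localization N cs ?y (maya N K) = ?W * excited_sum x L K" if "diagram K" "K \<subseteq> L" for K
    using excited_sum_localization[OF q cs(1), of N K] rows that by (simp add: cs(2) x_def)
  have wt0: "wt ?y (maya N L) \<noteq> 0" using q(1) by (simp add: wt_def)
  have "wt ?y (maya N L) * (?W * excited_sum x L M) =
      wt ?y (maya N M) * (\<Sum>J\<in>Pow {c \<in> L. addable M c}. localization N cs ?y (maya N (M \<union> J)))"
    using chevalley_diagram[OF cs(1) _ N _ M(1), of ?y] rows M q(1) by (simp add: cs(2) loc)
  also have "(\<Sum>J\<in>Pow {c \<in> L. addable M c}. localization N cs ?y (maya N (M \<union> J))) =
      (\<Sum>J\<in>Pow {c \<in> L. addable M c}. ?W * excited_sum x L (M \<union> J))"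
  proof (intro sum.cong refl)
    fix J assume J: "J \<in> Pow {c \<in> L. addable M c}"
    then have "finite J" by (intro finite_subset[OF _ fL]) auto
    then show "localization N cs ?y (maya N (M \<union> J)) = ?W * excited_sum x L (M \<union> J)"
      using J M by (intro loc diagram_union_addable) auto
  qed
  also have "\<dots> = ?W * (\<Sum>J\<in>Pow {c \<in> L. addable M c}. excited_sum x L (M \<union> J))"
    by (simp add: sum_distrib_left)
  finally show ?thesis
    unfolding wt_maya_ratio[OF q(1) L rows M] using W wt0 by (simp add: mult_ac)
qed

text \<open>Both sides obey one recursion on the number of skew cells: solving
  \<open>excited_sum_recursion\<close> for its \<open>J = {}\<close> term turns \<open>q ^ n\<close>
  into \<open>x n\<close>, the factor in \<open>tableaux_recursion\<close>.\<close>

theorem tableaux_sum_eq_excited_sum: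
  fixes q :: "'a::field"
  assumes q: "q \<noteq> 0" "\<And>n. 0 < n \<Longrightarrow> q ^ n \<noteq> 1"
    and L: "diagram L" and M: "diagram M" "M \<subseteq> L"
  defines "x \<equiv> \<lambda>n. q ^ n / (1 - q ^ n)"
  shows "(\<Sum>T\<in>tableaux (L - M). tableau_weight x (L - M) T) = excited_sum x L M"
  using M
proof (induction "card (L - M)" arbitrary: M rule: less_induct)
  case less
  have fL: "finite L" using L by (rule diagram_finite)
  show ?case
  proof (cases "M = L")
    case True
    \<comment> \<open>On the empty shape only the zero filling remains, with empty product 1;
      likewise the only excited diagram is \<open>L\<close>, whose complement is empty.\<close>
    have "tableaux {} = {\<lambda>_. 0}" by (auto simp: tableaux_def intro: exI[of _ 0])
    moreover have "exc L L = {L}" using exc_self exc.start by blast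
    ultimately show ?thesis using True by (simp add: tableau_weight_def excited_sum_def)
  next
    case False
    let ?n = "card (L - M)" and ?P = "Pow {c \<in> L. addable M c}"
    let ?S = "\<Sum>J\<in>?P - {{}}. excited_sum x L (M \<union> J)"
    have "0 < ?n" using False less.prems fL by (auto simp: card_gt_0_iff)
    then have n: "1 - q ^ ?n \<noteq> 0" using q(2) by simp
    have "(\<Sum>T\<in>tableaux (L - M). tableau_weight x (L - M) T) =
        x ?n * (\<Sum>J\<in>?P - {{}}. \<Sum>T\<in>tableaux (L - (M \<union> J)). tableau_weight x (L - (M \<union> J)) T)"
      by (rule tableaux_recursion[OF less.prems False L])
    also have "(\<Sum>J\<in>?P - {{}}. \<Sum>T\<in>tableaux (L - (M \<union> J)). tableau_weight x (L - (M \<union> J)) T) = ?S"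
    proof (intro sum.cong refl)
      fix J assume J: "J \<in> ?P - {{}}"
      then have "finite J" by (intro finite_subset[OF _ fL]) auto
      then have dgm: "diagram (M \<union> J)"
        using J less.prems by (intro diagram_union_addable) auto
      have "L - (M \<union> J) \<subset> L - M" using J by (auto simp: addable_def)
      then have "card (L - (M \<union> J)) < ?n" using fL by (intro psubset_card_mono) auto
      then show "(\<Sum>T\<in>tableaux (L - (M \<union> J)). tableau_weight x (L - (M \<union> J)) T) = excited_sum x L (M \<union> J)"
        using J less.prems dgm by (intro less.hyps) auto
    qed
    finally have lhs: "(\<Sum>T\<in>tableaux (L - M). tableau_weight x (L - M) T) = x ?n * ?S" .
    have "excited_sum x L M = q ^ ?n * (\<Sum>J\<in>?P. excited_sum x L (M \<union> J))"
      unfolding x_def by (rule excited_sum_recursion[OF q L less.prems])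
    also have "(\<Sum>J\<in>?P. excited_sum x L (M \<union> J)) = excited_sum x L M + ?S"
      using fL by (subst sum.remove[of _ "{}"]) auto
    finally have rec: "excited_sum x L M = q ^ ?n * (excited_sum x L M + ?S)" .
    have "e = a / (1 - a) * s" if "e = a * (e + s)" "1 - a \<noteq> 0" for a e s :: 'a
    proof -
      have "(1 - a) * e = a * s" using that(1) by (metis add_diff_cancel_left' distrib_left left_diff_distrib mult_1)
      then show ?thesis using that(2) by (metis nonzero_mult_div_cancel_left times_divide_eq_left)
    qed
    from this[OF rec n] show ?thesis unfolding lhs by (simp only: x_def)
  qed
qed

section \<open>Passage from lists to cell sets and to rational functions\<close>

lemma young_row: "1 \<le> i \<Longrightarrow> {j. (i, j) \<in> young lam} = {1..part lam i}"
  by (auto simp: young_def)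

lemma part_antimono:
  assumes "is_partition lam" "1 \<le> i" "i \<le> i'"
  shows "part lam i' \<le> part lam i"
proof (cases "i < i' \<and> i' \<le> length lam")
  case True
  then show ?thesis
    using assms sorted_wrt_nth_less[of "(\<ge>)" lam "i - 1" "i' - 1"] by (auto simp: part_def is_partition_def)
qed (use assms in \<open>auto simp: part_def\<close>)

lemma diagram_young:
  assumes "is_partition lam"
  shows "diagram (young lam)"
  unfolding diagram_def
proof (intro conjI allI impI)
  have "young lam \<subseteq> Sigma {..length lam} (\<lambda>i. {..part lam i})"
    by (auto simp: young_def part_def split: if_splits)
  then show "finite (young lam)" by (rule finite_subset) auto
next
  fix i j i' j' assume "(i, j) \<in> young lam" "1 \<le> i'" "i' \<le> i" "1 \<le> j'" "j' \<le> j"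
  then show "(i', j') \<in> young lam"
    using part_antimono[OF assms, of i' i] by (auto simp: young_def)
qed (auto simp: young_def)

lemma hook_eq_hook_len:
  assumes "c \<in> young lam"
  shows "hook lam c = hook_len (young lam) c"
proof -
  obtain i j where c: "c = (i, j)" by fastforce
  have "1 \<le> i" using assms by (simp add: c young_def)
  then have "row_len (young lam) i = part lam i" by (simp add: row_len_def young_row)
  then show ?thesis by (simp add: c hook_def hook_len_def conj_part_def col_len_def)
qed

text \<open>Double counting of the pairs of a cell \<open>c\<close> and a level
  \<open>k < T c\<close>.\<close>

lemma sum_eq_sum_card_ge:
  fixes T :: "'b \<Rightarrow> nat"
  assumes "finite A" "\<And>c. c \<in> A \<Longrightarrow> T c \<le> m"
  shows "(\<Sum>c\<in>A. T c) = (\<Sum>k<m. card {c \<in> A. k < T c})"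
proof -
  have "(\<Sum>c\<in>A. T c) = (\<Sum>c\<in>A. \<Sum>k<m. if k < T c then 1 else 0)"
  proof (intro sum.cong refl)
    fix c assume "c \<in> A"
    then have "{..<m} \<inter> {k. k < T c} = {..<T c}" using assms(2) by force
    then show "T c = (\<Sum>k<m. if k < T c then 1 else 0)" by (simp add: sum.If_cases)
  qed
  also have "\<dots> = (\<Sum>k<m. \<Sum>c\<in>A. if k < T c then 1 else 0)" by (rule sum.swap)
  also have "\<dots> = (\<Sum>k<m. card {c \<in> A. k < T c})"
    using assms(1) by (intro sum.cong refl) (simp add: sum.If_cases Int_def)
  finally show ?thesis .
qed

lemma tableau_weight_skew:
  fixes q :: "'a::field"
  assumes "finite (skew lam mu)" "T \<in> SIT lam mu"
  shows "q ^ weight lam mu T * (\<Prod>k = 1..mT lam mu T. 1 / (1 - q ^ a_ge lam mu T k)) =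
    tableau_weight (\<lambda>n. q ^ n / (1 - q ^ n)) (skew lam mu) T"
proof -
  let ?A = "skew lam mu"
  obtain m where m: "T ` ?A = {1..m}" using assms(2) by (auto simp: SIT_def)
  have "T c \<le> m" if "c \<in> ?A" for c using m that by (metis atLeastAtMost_iff image_eqI)
  then have "weight lam mu T = (\<Sum>k<m. card {c \<in> ?A. k < T c})"
    unfolding weight_def by (intro sum_eq_sum_card_ge assms(1))
  moreover have "mT lam mu T = m" by (simp add: mT_def m)
  moreover have "a_ge lam mu T (Suc k) = card {c \<in> ?A. k < T c}" for k
    by (simp add: a_ge_def Suc_le_eq)
  ultimately show ?thesis
    by (simp add: tableau_weight_def m power_sum prod.atLeast1_atMost_eq prod_dividef)
qed

lemma qX_power: "qX ^ n = Fract ([:0, 1:] ^ n) 1"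
  by (induction n) (simp_all add: qX_def One_fract_def)

lemma qX_nonzero: "qX \<noteq> 0"
  by (simp add: qX_def Zero_fract_def eq_fract)

lemma qX_power_neq_1:
  assumes "0 < n"
  shows "qX ^ n \<noteq> 1"
proof
  assume "qX ^ n = 1"
  then have "[:0, 1::rat:] ^ n = 1" by (simp add: qX_power One_fract_def eq_fract)
  then have "degree ([:0, 1::rat:] ^ n) = 0" by simp
  then show False using assms by (simp add: degree_power_eq)
qed

theorem theorem1p5:
  fixes lam mu :: "nat list"
  assumes "is_partition lam" and "is_partition mu" and "young mu \<subseteq> young lam"
  shows "(\<Sum>T\<in>SIT lam mu. qX ^ weight lam mu T *
            (\<Prod>k = 1..mT lam mu T. 1 / (1 - qX ^ a_ge lam mu T k)))
       = (\<Sum>D\<in>excited lam mu. \<Prod>c\<in>young lam - D. qX ^ hook lam c / (1 - qX ^ hook lam c))"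
proof -
  let ?L = "young lam" and ?M = "young mu" and ?x = "\<lambda>n. qX ^ n / (1 - qX ^ n)"
  have L: "diagram ?L" and M: "diagram ?M" using diagram_young assms by auto
  have fin: "finite (skew lam mu)" using diagram_finite[OF L] by (simp add: skew_def)
  have SIT: "SIT lam mu = tableaux (skew lam mu)" by (simp add: SIT_def tableaux_def)
  have "(\<Sum>T\<in>SIT lam mu. qX ^ weight lam mu T * (\<Prod>k = 1..mT lam mu T. 1 / (1 - qX ^ a_ge lam mu T k)))
      = (\<Sum>T\<in>tableaux (?L - ?M). tableau_weight ?x (?L - ?M) T)"
    unfolding skew_def[symmetric] by (intro sum.cong SIT tableau_weight_skew[OF fin]) (simp add: SIT)
  also have "\<dots> = excited_sum ?x ?L ?M"
    by (rule tableaux_sum_eq_excited_sum[OF qX_nonzero qX_power_neq_1 L M assms(3)])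
  also have "\<dots> = (\<Sum>D\<in>excited lam mu. \<Prod>c\<in>?L - D. qX ^ hook lam c / (1 - qX ^ hook lam c))"
    unfolding excited_sum_def excited_eq_exc by (intro sum.cong prod.cong) (auto simp: hook_eq_hook_len)
  finally show ?thesis .
qed

end
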